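(* Let $d\ge 1$ and let $(u_n)$ be a bounded sequence in $L^2(\mathbb{T}^d)$ satisfying the following condition: there exists a sequence of positive reals $(h_n)$ tending to zero such that $$\limsup_{n\to\infty}\sum_{|l|<\delta/h_n}|\widehat{u_n}(l)|^2\to 0\quad\text{as }\delta\to0^+,$$ and $$\limsup_{n\to\infty}\sum_{|l|>R/h_n}|\widehat{u_n}(l)|^2\to 0\quad\text{as }R\to\infty.$$ Let $\nu\in L^\infty(\mathbb{T};L^1(\mathbb{T}^d))$ be a weak-$*$ accumulation point of the sequence $(|e^{it\Delta}u_n|^2)$. If $\widehat{\nu}(l,s)$, $(l,s)\in\mathbb{Z}^d\times\mathbb{Z}$, are the Fourier coefficients of $\nu$ as a function of $(x,t)\in\mathbb{T}^d\times\mathbb{T}$, then $$\Vert\widehat{\nu}\Vert_{l^d(\mathbb{Z}^{d+1})}<\infty.$$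
   Context: $\mathbb{T}^d:=\mathbb{R}^d/2\pi\mathbb{Z}^d$ and $\mathbb{T}:=\mathbb{R}/2\pi\mathbb{Z}$. For $u\in L^2(\mathbb{T}^d)$ with Fourier coefficients $\widehat{u}(k)$, i.e. $u(x)=\sum_{k\in\mathbb{Z}^d}\widehat u(k)e^{ik\cdot x}$, $e^{it\Delta}u(x)=\sum_{k\in\mathbb{Z}^d}\widehat u(k)e^{i(k\cdot x-|k|^2t)}$ is the solution of $i\partial_t\psi+\Delta\psi=0$, $\psi(\cdot,0)=u$; it is $2\pi$-periodic in $t$. Let $\mathcal{M}_+(\mathbb{T}^d)$ be the set of positive Radon measures on $\mathbb{T}^d$. A measure $\nu\in L^\infty(\mathbb{T};\mathcal{M}_+(\mathbb{T}^d))$ is a weak-$*$ accumulation point of $(|e^{it\Delta}u_n|^2)$ if there is a subsequence $(u_{n'})$ such that $$\lim_{n'\to\infty}\int_{\mathbb{T}\times\mathbb{T}^d}\phi(t)a(x)|e^{it\Delta}u_{n'}(x)|^2\,dt\,dx=\int_{\mathbb{T}}\int_{\mathbb{T}^d}\phi(t)a(x)\,\nu(dx,t)\,dt$$ for every $\phi\in L^1(\mathbb{T})$ and every $a\in C(\mathbb{T}^d)$. (It is a known result of Bourgain that every such accumulation point is absolutely continuous, i.e. belongs to $L^\infty(\mathbb{T};L^1(\mathbb{T}^d))$.) The Fourier coefficients of $\nu$ are those for which $\nu(x,t)=\sum_{(l,s)}\widehat\nu(l,s)e^{i(l\cdot x+st)}$. *)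

theory Defs
  imports "HOL-Analysis.Analysis"
begin

text \<open>
  The torus is represented by its fundamental cell, the half-open cube of side \<open>2\<pi>\<close>, with
  Lebesgue measure of total mass \<open>(2\<pi>)^d\<close>; likewise the circle. Measurable functions and Borel
  measures on the torus are those on the cell, so they carry no periodicity condition. Periodicity
  is required only of continuous functions on the torus, which are functions on the whole space.
\<close>

definition torus :: "(real ^ 'd) measure" where
  "torus = restrict_space lborel {x. \<forall>i. 0 \<le> x $ i \<and> x $ i < 2 * pi}"

definition circle :: "real measure" where
  "circle = restrict_space lborel {0..<2 * pi}"

definition int_vec :: "int ^ 'd \<Rightarrow> real ^ 'd" where
  "int_vec k = (\<chi> i. real_of_int (k $ i))"

definition continuous_torus :: "(real ^ 'd \<Rightarrow> complex) \<Rightarrow> bool" where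
  "continuous_torus a \<longleftrightarrow>
     continuous_on UNIV a \<and> (\<forall>x k. a (x + (2 * pi) *\<^sub>R int_vec k) = a x)"

definition L2_torus :: "(real ^ 'd \<Rightarrow> complex) set" where
  "L2_torus = {u \<in> borel_measurable torus. integrable torus (\<lambda>x. (cmod (u x))\<^sup>2)}"

definition L2_norm_torus :: "(real ^ 'd \<Rightarrow> complex) \<Rightarrow> real" where
  "L2_norm_torus u = sqrt (\<integral>x. (cmod (u x))\<^sup>2 \<partial>torus)"

definition fourier_coeff :: "(real ^ 'd \<Rightarrow> complex) \<Rightarrow> int ^ 'd \<Rightarrow> complex" where
  "fourier_coeff u k = (\<integral>x. u x * cis (- (int_vec k \<bullet> x)) \<partial>torus) / (2 * pi) ^ CARD('d)"

definition spacetime_fourier_coeff ::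
    "(real ^ 'd \<Rightarrow> real \<Rightarrow> real) \<Rightarrow> (int ^ 'd) \<times> int \<Rightarrow> complex" where
  "spacetime_fourier_coeff \<nu> = (\<lambda>(l, s).
     (\<integral>(x, t). of_real (\<nu> x t) * cis (- (int_vec l \<bullet> x + real_of_int s * t)) \<partial>(torus \<Otimes>\<^sub>M circle))
       / (2 * pi) ^ (CARD('d) + 1))"

text \<open>
  \<open>schroedinger_evolution u \<psi>\<close> says that \<open>\<psi>\<close> is a jointly measurable representative of the
  function mapping \<open>(x,t)\<close> to \<open>exp(it\<Delta>)u(x)\<close>: at each time \<open>t\<close>, the Fourier series of the
  latter converges unconditionally in \<open>L\<^sup>2\<close> to \<open>\<psi>(\<cdot>,t)\<close>, which determines \<open>\<psi>(\<cdot>,t)\<close> up to a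
  null set. Such a \<open>\<psi>\<close> exists for every \<open>u\<close> in \<open>L\<^sup>2\<close>: the \<open>L\<^sup>2\<close> norms of the tails of the series
  do not depend on \<open>t\<close>, so one sequence of partial sums converges for all \<open>t\<close> and almost every \<open>x\<close>.
\<close>

definition schroedinger_evolution ::
    "(real ^ 'd \<Rightarrow> complex) \<Rightarrow> (real ^ 'd \<Rightarrow> real \<Rightarrow> complex) \<Rightarrow> bool" where
  "schroedinger_evolution u \<psi> \<longleftrightarrow>
     (\<lambda>(x, t). \<psi> x t) \<in> borel_measurable (torus \<Otimes>\<^sub>M circle) \<and>
     (\<forall>t \<in> space circle.
        (\<lambda>x. \<psi> x t) \<in> L2_torus \<and>
        ((\<lambda>K. L2_norm_torus (\<lambda>x. \<psi> x t -
             (\<Sum>k\<in>K. fourier_coeff u k * cis (int_vec k \<bullet> x - (norm (int_vec k))\<^sup>2 * t))))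
          \<longlongrightarrow> 0) (finite_subsets_at_top UNIV))"

text \<open>
  Members of \<open>L\<^sup>\<infinity>(\<bbbT>; M\<^sub>+(\<bbbT>\<^sup>d))\<close>: weak-\<open>*\<close> measurable families of
  positive Borel measures of essentially bounded mass. On a compact metric space the positive
  Radon measures are the finite Borel measures.
\<close>

definition Linf_measures :: "(real \<Rightarrow> (real ^ 'd) measure) set" where
  "Linf_measures = {\<mu>.
     (\<exists>C::real. AE t in circle. sets (\<mu> t) = sets torus \<and> emeasure (\<mu> t) (space torus) \<le> ennreal C) \<and>
     (\<forall>a. continuous_torus a \<longrightarrow> (\<lambda>t. \<integral>x. a x \<partial>\<mu> t) \<in> borel_measurable circle)}"

definition Linf_L1 :: "(real ^ 'd \<Rightarrow> real \<Rightarrow> real) set" where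
  "Linf_L1 = {\<nu>.
     (\<lambda>(x, t). \<nu> x t) \<in> borel_measurable (torus \<Otimes>\<^sub>M circle) \<and>
     (\<exists>C. AE t in circle. integrable torus (\<lambda>x. \<nu> x t) \<and> (\<integral>x. \<bar>\<nu> x t\<bar> \<partial>torus) \<le> C)}"

text \<open>
  The family \<open>t \<mapsto> \<nu>(\<cdot>,t) dx\<close>. Since \<^const>\<open>ennreal\<close> truncates negative values, this
  represents \<open>\<nu>\<close> only if \<open>\<nu>\<close> is nonnegative almost everywhere.
\<close>

definition density_family :: "(real ^ 'd \<Rightarrow> real \<Rightarrow> real) \<Rightarrow> real \<Rightarrow> (real ^ 'd) measure" where
  "density_family \<nu> t = density torus (\<lambda>x. ennreal (\<nu> x t))"

definition weak_star_accumulation_point ::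
    "(nat \<Rightarrow> real ^ 'd \<Rightarrow> real \<Rightarrow> real) \<Rightarrow> (real \<Rightarrow> (real ^ 'd) measure) \<Rightarrow> bool" where
  "weak_star_accumulation_point f \<mu> \<longleftrightarrow> \<mu> \<in> Linf_measures \<and>
     (\<exists>r. strict_mono r \<and>
       (\<forall>(\<phi> :: real \<Rightarrow> complex) a. integrable circle \<phi> \<longrightarrow> continuous_torus a \<longrightarrow>
         (\<lambda>n. \<integral>(x, t). \<phi> t * a x * of_real (f (r n) x t) \<partial>(torus \<Otimes>\<^sub>M circle))
           \<longlonglongrightarrow> (\<integral>t. \<phi> t * (\<integral>x. a x \<partial>\<mu> t) \<partial>circle)))"

definition lp_norm :: "real \<Rightarrow> ('i \<Rightarrow> complex) \<Rightarrow> ennreal" where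
  "lp_norm p c =
     (if (\<lambda>i. cmod (c i) powr p) summable_on UNIV
      then ennreal ((\<Sum>\<^sub>\<infinity>i. cmod (c i) powr p) powr (1 / p)) else \<infinity>)"

end

theory Submission
  imports Defs
begin

text \<open>
  Write \<open>u^(k)\<close> for the Fourier coefficients of \<open>u\<close> and \<open>d\<close> for the dimension. The Fourier coefficient
  of \<open>|exp(it\<Delta>)u|\<^sup>2\<close> at \<open>(l,s)\<close> is the sum of \<open>u^(k) * cnj (u^(k - l))\<close> over the frequencies \<open>k\<close> with
  \<open>|k - l|\<^sup>2 - |k|\<^sup>2 = s\<close>. A term is a chord of the paraboloid, with prescribed difference, and for fixed
  \<open>(l,s)\<close> with \<open>l \<noteq> 0\<close> the starting points \<open>k\<close> all lie on one hyperplane orthogonal to \<open>l\<close>.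

  Suppose first that the frequencies of \<open>u\<close> lie in a proper affine subspace. The \<open>d\<close>-th power of a
  coefficient is a sum over \<open>d\<close>-tuples of parallel chords. The \<open>d\<close> starting points now lie in an affine
  space of dimension \<open>d - 2\<close>, so one of them is in the affine hull of the others, and as \<open>l\<close> is
  orthogonal to that hull it is the foot of the perpendicular dropped from its own end point. The whole
  tuple is thus determined by the other \<open>d - 1\<close> starting points and this one end point. Splitting
  each product by the arithmetic-geometric mean inequality accordingly gives, with no dependence on how
  many pairs \<open>(l,s)\<close> are considered, a bound of the sum of the \<open>d\<close>-th powers of the coefficients by
  \<open>d * (\<Sum>k. |u^(k)|\<^sup>2)^d\<close>; this is \<open>degenerate_chord_bound\<close>.

  In general fix finitely many pairs \<open>(l,s)\<close>. The end points of a chord have inner products with \<open>l\<close>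
  that are bounded in terms of \<open>(l,s)\<close>, so join any two points that differ by one of these \<open>l\<close> and are
  both almost orthogonal to it in this sense. The connected components of this graph have
  uniformly bounded diameter (\<open>walks_bounded\<close>). All directions used in a component far from the origin are
  therefore almost orthogonal to one and the same large vector, so they cannot span the space: each
  far component lies in a proper affine subspace (\<open>far_walks_degenerate\<close>). Chords never leave a component,
  and by convexity the bounds for the components combine into the same bound for all far
  frequencies (\<open>far_chord_bound\<close>).

  Frequencies in a fixed ball are negligible in the limit, because the mass of \<open>u\<^sub>n\<close> below \<open>\<delta> / h\<^sub>n\<close> is
  small for small \<open>\<delta>\<close> and large \<open>n\<close>. So every finite set of coefficients of \<open>\<nu>\<close> with \<open>l \<noteq> 0\<close> obeys the bound, while
  conservation of mass makes the coefficients at \<open>(0,s)\<close> with \<open>s \<noteq> 0\<close> vanish.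
\<close>

section \<open>Components of the resonance graph\<close>

text \<open>
  The form \<open>\<Sum>l\<in>L. (x \<bullet> l)\<^sup>2\<close> is positive definite on the span of \<open>L\<close>, which is finite-dimensional.
\<close>

lemma norm_bounded_on_span:
  fixes L :: "'a::euclidean_space set"
  assumes "finite L"
  shows "\<exists>D. \<forall>x\<in>span L. (\<forall>l\<in>L. \<bar>x \<bullet> l\<bar> \<le> N) \<longrightarrow> norm x \<le> D"
proof -
  \<comment> \<open>A sum of multiples of the vectors themselves, so that \<open>x \<bullet> f x\<close> is the form in question.\<close>
  define f where "f x = (\<Sum>l\<in>L. (x \<bullet> l) *\<^sub>R l)" for x
  have "linear f"
    unfolding f_def
    by (rule linearI) (simp_all add: inner_add_left scaleR_add_left sum.distrib scaleR_sum_right)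
  have "x = 0" if x: "x \<in> span L" and "f x = 0" for x
  proof -
    have "(\<Sum>l\<in>L. (x \<bullet> l)\<^sup>2) = x \<bullet> f x"
      by (simp add: f_def inner_sum_right power2_eq_square)
    then have "\<forall>l\<in>L. x \<bullet> l = 0"
      using \<open>f x = 0\<close> assms by (simp add: sum_nonneg_eq_0_iff)
    then have "orthogonal x x"
      using x orthogonal_to_span by (metis orthogonal_def orthogonal_clauses(2) orthogonal_commute)
    then show ?thesis by (simp add: orthogonal_self)
  qed
  then obtain e where e: "e > 0" "\<forall>x\<in>span L. e * norm x \<le> norm (f x)"
    using injective_imp_isometric[of "span L" f] \<open>linear f\<close>
    by (auto simp: closed_subspace linear_conv_bounded_linear)
  show ?thesis
  proof (intro exI ballI impI)
    fix x assume x: "x \<in> span L" "\<forall>l\<in>L. \<bar>x \<bullet> l\<bar> \<le> N"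
    have "norm (f x) \<le> (\<Sum>l\<in>L. N * norm l)"
      unfolding f_def by (rule sum_norm_le) (use x(2) in \<open>auto intro: mult_right_mono\<close>)
    with e x(1) show "norm x \<le> (\<Sum>l\<in>L. N * norm l) / e"
      by (simp add: pos_le_divide_eq mult.commute) (meson order_trans)
  qed
qed

text \<open>
  The bound is imposed at both ends of a step so that the relation is symmetric; the components of the
  graph are then the classes of its reflexive transitive closure.
\<close>

definition resonant_steps :: "'a::euclidean_space set \<Rightarrow> real \<Rightarrow> 'a rel" where
  "resonant_steps L M =
     {(k, k'). \<exists>l\<in>L. (k' = k - l \<or> k' = k + l) \<and> \<bar>k \<bullet> l\<bar> \<le> M \<and> \<bar>k' \<bullet> l\<bar> \<le> M}"

lemma sym_walks: "sym ((resonant_steps L M)\<^sup>*)"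
  by (intro sym_rtrancl symI) (force simp: resonant_steps_def)

lemma walk_in_span:
  assumes "(k, k') \<in> (resonant_steps L M)\<^sup>*"
  shows "k' - k \<in> span L"
  using assms
proof (induction rule: rtrancl_induct)
  case base
  show ?case by (simp add: span_zero)
next
  case (step y z)
  then obtain l where "l \<in> L" and z: "z = y - l \<or> z = y + l"
    by (auto simp: resonant_steps_def)
  then have "(y - k) - l \<in> span L" "(y - k) + l \<in> span L"
    using step.IH by (auto intro: span_diff span_add span_base)
  with z show ?case by (auto simp: algebra_simps)
qed

text \<open>
  Induction on the set of available directions. If somewhere along the component some \<open>l\<close> has a large
  inner product with the current point, then walks without \<open>l\<close> move so little that \<open>l\<close> never becomes
  available, and the induction hypothesis for \<open>L - {l}\<close> applies. Otherwise all inner products with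
  \<open>L\<close> stay bounded, which bounds the displacement because it is in the span of \<open>L\<close>.
\<close>

lemma walks_bounded:
  fixes L :: "'a::euclidean_space set"
  assumes "finite L"
  shows "\<exists>D. \<forall>k k'. (k, k') \<in> (resonant_steps L M)\<^sup>* \<longrightarrow> norm (k' - k) \<le> D"
  using assms
proof (induction L rule: finite_psubset_induct)
  case (psubset L)
  have "\<forall>l\<in>L. \<forall>\<^sub>F D in at_top. \<forall>k k'. (k, k') \<in> (resonant_steps (L - {l}) M)\<^sup>* \<longrightarrow> norm (k' - k) \<le> D"
  proof
    fix l assume "l \<in> L"
    then obtain D where D: "(k, k') \<in> (resonant_steps (L - {l}) M)\<^sup>* \<Longrightarrow> norm (k' - k) \<le> D" for k k'
      using psubset.IH[of "L - {l}"] by auto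
    show "\<forall>\<^sub>F D in at_top. \<forall>k k'. (k, k') \<in> (resonant_steps (L - {l}) M)\<^sup>* \<longrightarrow> norm (k' - k) \<le> D"
      using eventually_ge_at_top[of D] by eventually_elim (use D order_trans in blast)
  qed
  then have "\<forall>\<^sub>F D in at_top. \<forall>l\<in>L. \<forall>k k'. (k, k') \<in> (resonant_steps (L - {l}) M)\<^sup>* \<longrightarrow> norm (k' - k) \<le> D"
    by (rule eventually_ball_finite[OF psubset.hyps])
  then obtain D where D: "\<And>l k k'. l \<in> L \<Longrightarrow> (k, k') \<in> (resonant_steps (L - {l}) M)\<^sup>* \<Longrightarrow> norm (k' - k) \<le> D"
    by (auto dest!: eventually_happens)
  define N where "N = M + D * (\<Sum>l\<in>L. norm l)"
  obtain D' where D': "x \<in> span L \<Longrightarrow> \<forall>l\<in>L. \<bar>x \<bullet> l\<bar> \<le> 2 * N \<Longrightarrow> norm x \<le> D'" for x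
    using norm_bounded_on_span[OF psubset.hyps, of "2 * N"] by auto
  show ?case
  proof (intro exI allI impI)
    fix k k' assume kk': "(k, k') \<in> (resonant_steps L M)\<^sup>*"
    show "norm (k' - k) \<le> max (2 * D) D'"
    proof (cases "\<exists>y. (k, y) \<in> (resonant_steps L M)\<^sup>* \<and> (\<exists>l\<in>L. \<bar>y \<bullet> l\<bar> > N)")
      case True
      then obtain y l where ky: "(k, y) \<in> (resonant_steps L M)\<^sup>*" and l: "l \<in> L" and y: "\<bar>y \<bullet> l\<bar> > N"
        by auto
      \<comment> \<open>From \<open>y\<close> on, the step \<open>l\<close> never becomes available.\<close>
      have far: "(y, z) \<in> (resonant_steps (L - {l}) M)\<^sup>*" if "(y, z) \<in> (resonant_steps L M)\<^sup>*" for z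
        using that
      proof (induction rule: rtrancl_induct)
        case base
        show ?case by simp
      next
        case (step z z')
        have zy: "norm (z - y) \<le> D" using D[OF l step.IH] .
        have "\<bar>(z - y) \<bullet> l\<bar> \<le> norm (z - y) * norm l" by (rule Cauchy_Schwarz_ineq2)
        also have "\<dots> \<le> D * (\<Sum>l\<in>L. norm l)"
          using zy l psubset.hyps order_trans[OF norm_ge_zero zy] by (intro mult_mono member_le_sum) auto
        finally have "\<bar>z \<bullet> l\<bar> > M" using y by (simp add: N_def inner_diff_left)
        then have "(z, z') \<in> resonant_steps (L - {l}) M"
          using step.hyps(2) by (auto simp: resonant_steps_def)
        with step.IH show ?case by (rule rtrancl_into_rtrancl)
      qed
      have yk: "(y, k) \<in> (resonant_steps L M)\<^sup>*" using ky by (rule symD[OF sym_walks])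
      have "norm (k - y) \<le> D" using D[OF l far[OF yk]] .
      moreover have "norm (k' - y) \<le> D" using D[OF l far[OF rtrancl_trans[OF yk kk']]] .
      ultimately have "norm ((k' - y) - (k - y)) \<le> 2 * D"
        using norm_triangle_ineq4[of "k' - y" "k - y"] by linarith
      then show ?thesis by simp
    next
      case False
      then have N: "\<bar>y \<bullet> l\<bar> \<le> N" if "(k, y) \<in> (resonant_steps L M)\<^sup>*" "l \<in> L" for y l
        using that by (auto simp: not_less)
      have "\<forall>l\<in>L. \<bar>(k' - k) \<bullet> l\<bar> \<le> 2 * N"
        using N[OF kk'] N[OF rtrancl_refl] by (fastforce simp: inner_diff_left)
      then show ?thesis using D'[OF walk_in_span[OF kk']] by simp
    qed
  qed
qed

text \<open>
  A direction used anywhere in the component of \<open>k\<close> has a bounded inner product with \<open>k\<close> itself, since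
  the component is bounded. If the used directions spanned the space, they would bound \<open>k\<close>. Taking \<open>v\<close>
  orthogonal to all of them, \<open>v \<bullet> y\<close> is constant on the component.
\<close>

lemma far_walks_degenerate:
  fixes L :: "'a::euclidean_space set"
  assumes "finite L"
  shows "\<exists>R. \<forall>k. norm k > R \<longrightarrow>
           (\<exists>v. v \<noteq> 0 \<and> (\<forall>y. (k, y) \<in> (resonant_steps L M)\<^sup>* \<longrightarrow> v \<bullet> (y - k) = 0))"
proof -
  obtain D where D: "(k, k') \<in> (resonant_steps L M)\<^sup>* \<Longrightarrow> norm (k' - k) \<le> D" for k k'
    using walks_bounded[OF assms] by metis
  define N where "N = M + D * (\<Sum>l\<in>L. norm l)"
  have "\<forall>U\<in>Pow L. \<forall>\<^sub>F R in at_top. \<forall>x\<in>span U. (\<forall>l\<in>U. \<bar>x \<bullet> l\<bar> \<le> N) \<longrightarrow> norm x \<le> R"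
  proof
    fix U assume "U \<in> Pow L"
    then have "finite U" using assms finite_subset by auto
    then obtain R where R: "\<forall>x\<in>span U. (\<forall>l\<in>U. \<bar>x \<bullet> l\<bar> \<le> N) \<longrightarrow> norm x \<le> R"
      using norm_bounded_on_span by blast
    show "\<forall>\<^sub>F R in at_top. \<forall>x\<in>span U. (\<forall>l\<in>U. \<bar>x \<bullet> l\<bar> \<le> N) \<longrightarrow> norm x \<le> R"
      using eventually_ge_at_top[of R] by eventually_elim (use R order_trans in blast)
  qed
  then have "\<forall>\<^sub>F R in at_top. \<forall>U\<in>Pow L. \<forall>x\<in>span U. (\<forall>l\<in>U. \<bar>x \<bullet> l\<bar> \<le> N) \<longrightarrow> norm x \<le> R"
    using assms by (intro eventually_ball_finite) auto
  then obtain R where "\<forall>U\<in>Pow L. \<forall>x\<in>span U. (\<forall>l\<in>U. \<bar>x \<bullet> l\<bar> \<le> N) \<longrightarrow> norm x \<le> R"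
    using eventually_happens'[OF trivial_limit_at_top_linorder] by blast
  then have R: "\<And>U x. U \<subseteq> L \<Longrightarrow> x \<in> span U \<Longrightarrow> \<forall>l\<in>U. \<bar>x \<bullet> l\<bar> \<le> N \<Longrightarrow> norm x \<le> R"
    by blast
  show ?thesis
  proof (rule exI[of _ R], intro allI impI)
    fix k :: 'a assume k: "norm k > R"
    \<comment> \<open>The directions that can be used somewhere in the component of \<open>k\<close>.\<close>
    define U where "U = {l\<in>L. \<exists>y. (k, y) \<in> (resonant_steps L M)\<^sup>* \<and> \<bar>y \<bullet> l\<bar> \<le> M}"
    have "\<bar>k \<bullet> l\<bar> \<le> N" if "l \<in> U" for l
    proof -
      from that obtain y where l: "l \<in> L" and ky: "(k, y) \<in> (resonant_steps L M)\<^sup>*" and y: "\<bar>y \<bullet> l\<bar> \<le> M"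
        by (auto simp: U_def)
      have "\<bar>(y - k) \<bullet> l\<bar> \<le> norm (y - k) * norm l" by (rule Cauchy_Schwarz_ineq2)
      also have "\<dots> \<le> D * (\<Sum>l\<in>L. norm l)"
        using D[OF ky] l assms order_trans[OF norm_ge_zero D[OF ky]]
        by (intro mult_mono member_le_sum) auto
      finally show ?thesis using y by (simp add: N_def inner_diff_left)
    qed
    then have "k \<notin> span U" using R[of U k] k by (fastforce simp: U_def)
    then have "span U \<noteq> UNIV" by auto
    then obtain v where v: "v \<noteq> 0" "span U \<subseteq> {x. v \<bullet> x = 0}"
      using span_not_univ_subset_hyperplane by blast
    have "v \<bullet> (y - k) = 0" if "(k, y) \<in> (resonant_steps L M)\<^sup>*" for y
      using that
    proof (induction rule: rtrancl_induct)
      case base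
      show ?case by simp
    next
      case (step y z)
      then obtain l where l: "l \<in> L" "z = y - l \<or> z = y + l" "\<bar>y \<bullet> l\<bar> \<le> M"
        by (auto simp: resonant_steps_def)
      then have "l \<in> U" using step.hyps by (auto simp: U_def)
      then have "v \<bullet> l = 0" using v(2) span_base by blast
      with l(2) step.IH show ?case by (auto simp: inner_diff_right inner_add_right)
    qed
    with v(1) show "\<exists>v. v \<noteq> 0 \<and> (\<forall>y. (k, y) \<in> (resonant_steps L M)\<^sup>* \<longrightarrow> v \<bullet> (y - k) = 0)"
      by blast
  qed
qed

section \<open>Chords of the paraboloid over a proper affine subspace\<close>

text \<open>
  The parameter is \<open>\<tau> = (l, s)\<close>. A chord is represented by its starting point \<open>k\<close>: it joins
  \<open>(k, |k|\<^sup>2)\<close> to \<open>(k - l, |k|\<^sup>2 + s)\<close>, both on the paraboloid.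
\<close>

definition chords :: "'a::euclidean_space set \<Rightarrow> 'a \<times> real \<Rightarrow> 'a set" where
  "chords K \<tau> = {k\<in>K. k - fst \<tau> \<in> K \<and> (norm (k - fst \<tau>))\<^sup>2 - (norm k)\<^sup>2 = snd \<tau>}"

definition chord_sum :: "('a::euclidean_space \<Rightarrow> real) \<Rightarrow> 'a set \<Rightarrow> 'a \<times> real \<Rightarrow> real" where
  "chord_sum w K \<tau> = (\<Sum>k\<in>chords K \<tau>. w k * w (k - fst \<tau>))"

lemma inner_chord:
  assumes "k \<in> chords K \<tau>"
  shows "2 * (k \<bullet> fst \<tau>) = (norm (fst \<tau>))\<^sup>2 - snd \<tau>"
    and "2 * ((k - fst \<tau>) \<bullet> fst \<tau>) = - (norm (fst \<tau>))\<^sup>2 - snd \<tau>"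
  using assms
  by (simp_all add: chords_def power2_norm_eq_inner inner_diff_left inner_diff_right inner_commute)

lemma chords_orthogonal:
  assumes "k \<in> chords K \<tau>" "k' \<in> chords K \<tau>"
  shows "(k - k') \<bullet> fst \<tau> = 0"
  using inner_chord(1)[OF assms(1)] inner_chord(1)[OF assms(2)] by (simp add: inner_diff_left)

text \<open>
  Were the points affinely independent, they would span the whole hyperplane orthogonal to \<open>l\<close>
  through any of them. This hyperplane contains the direction \<open>v\<close>, along which the points do not vary.
\<close>

lemma exists_dependent_index:
  fixes f :: "'d::finite \<Rightarrow> real ^ 'd"
  assumes "l \<noteq> 0" "v \<noteq> 0" "v \<bullet> l = 0"
    and l: "\<And>i j. (f i - f j) \<bullet> l = 0" and v: "\<And>i j. v \<bullet> (f i - f j) = 0"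
  shows "\<exists>i. f i \<in> affine hull (f ` (UNIV - {i}))"
proof (rule ccontr)
  assume neg: "\<not> ?thesis"
  have "inj f"
  proof (rule injI, rule ccontr)
    fix i j assume "f i = f j" "i \<noteq> j"
    then have "f i \<in> f ` (UNIV - {i})" by auto
    with neg show False using hull_inc by metis
  qed
  then have "range f - {f i} = f ` (UNIV - {i})" for i by (auto simp: inj_eq)
  then have "\<not> affine_dependent (range f)" using neg by (auto simp: affine_dependent_def)
  then have dim: "aff_dim (affine hull range f) = int CARD('d) - 1"
    using aff_dim_affine_independent[of "range f"] card_image[OF \<open>inj f\<close>] by (simp add: aff_dim_affine_hull)
  fix i :: 'd
  define H where "H = {x. l \<bullet> x = l \<bullet> f i}"
  have "range f \<subseteq> H" using l by (auto simp: H_def inner_diff_right inner_commute[of _ l])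
  then have "affine hull range f \<subseteq> H" unfolding H_def by (intro hull_minimal affine_hyperplane)
  moreover have "aff_dim H = int CARD('d) - 1"
    using \<open>l \<noteq> 0\<close> by (simp add: H_def of_nat_diff Suc_leI)
  ultimately have "affine hull range f = H"
    using dim by (intro affine_dim_equal) (auto simp: H_def affine_hyperplane)
  moreover have "f i + v \<in> H" using assms(3) by (simp add: H_def inner_add_right inner_commute)
  moreover have "affine hull range f \<subseteq> {x. v \<bullet> x = v \<bullet> f i}"
    using v by (intro hull_minimal affine_hyperplane) (auto simp: inner_diff_right)
  ultimately show False using \<open>v \<noteq> 0\<close> by (auto simp: inner_add_right)
qed

text \<open>
  A tuple of parallel chords is recovered after its \<open>i\<close>-th starting point has been replaced by the
  \<open>i\<close>-th end point, provided that the former lies in the affine hull of the remaining starting points: it is the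
  orthogonal projection of the end point onto that hull. This injectivity is what turns sums over tuples of chords into sums
  over free tuples of points.
\<close>

lemma foot_of_perpendicular_unique:
  fixes f f' :: "'d::finite \<Rightarrow> real ^ 'd"
  assumes dep: "f i \<in> affine hull (f ` (UNIV - {i}))" "f' i \<in> affine hull (f' ` (UNIV - {i}))"
    and perp: "\<And>j k. (f j - f k) \<bullet> l = 0" "\<And>j k. (f' j - f' k) \<bullet> l' = 0"
    and eq: "f(i := f i - l) = f'(i := f' i - l')"
  shows "l = l' \<and> f = f'"
proof -
  have off: "f j = f' j" if "j \<noteq> i" for j using fun_cong[OF eq, of j] that by simp
  have at: "f i - l = f' i - l'" using fun_cong[OF eq, of i] by simp
  define v where "v = f i - f' i"
  have v': "v = l - l'" using at by (simp add: v_def algebra_simps)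
  have W: "f ` (UNIV - {i}) = f' ` (UNIV - {i})" using off by (auto intro!: image_cong)
  have "UNIV - {i} \<noteq> {}" using dep(1) by (metis affine_hull_empty empty_iff image_empty)
  then obtain m where "m \<noteq> i" by auto
  have "v \<bullet> f j = v \<bullet> f m" if "j \<noteq> i" for j
    using perp(1)[of j m] perp(2)[of j m] off[OF that] off[OF \<open>m \<noteq> i\<close>]
    by (simp add: v' inner_diff_left inner_diff_right inner_commute)
  then have "affine hull (f ` (UNIV - {i})) \<subseteq> {x. v \<bullet> x = v \<bullet> f m}"
    by (intro hull_minimal affine_hyperplane) auto
  then have "v \<bullet> x = v \<bullet> f m" if "x \<in> affine hull (f ` (UNIV - {i}))" for x
    using that by blast
  then have "v \<bullet> f i = v \<bullet> f' i" using dep W by metis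
  then have "v \<bullet> v = 0" by (simp add: v_def inner_diff_right)
  then have "f i = f' i" "l = l'" using v_def v' by auto
  then show ?thesis using off by (metis ext)
qed

lemma sum_inj_le:
  fixes W :: "'b \<Rightarrow> real"
  assumes "inj_on h A" "h ` A \<subseteq> B" "finite B" "\<And>b. b \<in> B \<Longrightarrow> W b \<ge> 0"
  shows "(\<Sum>a\<in>A. W (h a)) \<le> (\<Sum>b\<in>B. W b)"
proof -
  have "(\<Sum>a\<in>A. W (h a)) = (\<Sum>b\<in>h ` A. W b)" using assms(1) by (simp add: sum.reindex)
  also have "\<dots> \<le> (\<Sum>b\<in>B. W b)" using assms by (intro sum_mono2) auto
  finally show ?thesis .
qed

lemma power_sum_eq_sum_tuples:
  fixes a :: "'b \<Rightarrow> 'c::comm_semiring_1"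
  assumes "finite A"
  shows "(\<Sum>x\<in>A. a x) ^ CARD('d::finite) = (\<Sum>f\<in>PiE (UNIV::'d set) (\<lambda>_. A). \<Prod>i\<in>UNIV. a (f i))"
  using prod_sum_PiE[of "UNIV::'d set" "\<lambda>_. A" "\<lambda>_. a"] assms by simp

text \<open>
  In the expansion of the \<open>d\<close>-th power, choose for each tuple of chords an index \<open>i\<close> as in
  \<open>exists_dependent_index\<close>. The product of the \<open>2 * d\<close> weights is the weight of the starting points with
  the \<open>i\<close>-th one replaced by its end point, times the weight of the end points with the \<open>i\<close>-th one
  replaced by its starting point. By \<open>2 * A * B \<le> A\<^sup>2 + B\<^sup>2\<close> and
  \<open>foot_of_perpendicular_unique\<close>, each of the two contributions for given \<open>i\<close> is at most the sum of the
  squared weights over all \<open>d\<close>-tuples of points of \<open>X\<close>.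
\<close>

lemma degenerate_chord_bound:
  fixes X :: "(real ^ 'd::finite) set" and w :: "real ^ 'd \<Rightarrow> real"
  assumes "finite X" "finite F" and nz: "\<And>\<tau>. \<tau> \<in> F \<Longrightarrow> fst \<tau> \<noteq> 0"
    and "v \<noteq> 0" and v: "\<And>x y. x \<in> X \<Longrightarrow> y \<in> X \<Longrightarrow> v \<bullet> (x - y) = 0"
  shows "(\<Sum>\<tau>\<in>F. chord_sum w X \<tau> ^ CARD('d)) \<le> CARD('d) * (\<Sum>x\<in>X. (w x)\<^sup>2) ^ CARD('d)"
proof -
  let ?T = "PiE (UNIV :: 'd set) (\<lambda>_. X)"
  define conf where "conf = (SIGMA \<tau>:F. PiE (UNIV :: 'd set) (\<lambda>_. chords X \<tau>))"
  define weight where "weight = (\<lambda>((l, s::real), f::'d \<Rightarrow> real ^ 'd). \<Prod>i\<in>UNIV. w (f i) * w (f i - l))"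
  define P where "P g = (\<Prod>j\<in>UNIV. (w (g j))\<^sup>2)" for g :: "'d \<Rightarrow> real ^ 'd"
  \<comment> \<open>Interchange the two ends of the \<open>i\<close>-th chord and keep all starting points, respectively all end points.\<close>
  define G where "G i = (\<lambda>((l, s::real), f). f(i := f i - l :: real ^ 'd))" for i :: 'd
  define G' where "G' i = (\<lambda>((l, s::real), f). (\<lambda>j. f j - l)(i := f i :: real ^ 'd))" for i :: 'd
  \<comment> \<open>The tuples whose \<open>i\<close>-th starting point is in the affine hull of the others.\<close>
  define dep where "dep i = {p \<in> conf. snd p i \<in> affine hull (snd p ` (UNIV - {i}))}" for i :: 'd
  have fin: "finite (chords X \<tau>)" for \<tau> using assms(1) by (simp add: chords_def)
  have "finite conf" unfolding conf_def using assms(2) fin by (intro finite_SigmaI finite_PiE) auto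
  have finT: "finite ?T" using assms(1) by (intro finite_PiE) auto
  have chord: "f i \<in> chords X (l, s)" if "((l, s), f) \<in> conf" for l s f i
    using that by (auto simp: conf_def PiE_iff)
  have in_X: "f i \<in> X" "f i - l \<in> X" if "((l, s), f) \<in> conf" for l s f i
    using chord[OF that, of i] by (auto simp: chords_def)
  have perp: "(f i - f j) \<bullet> l = 0" if "((l, s), f) \<in> conf" for l s f i j
    using chords_orthogonal[OF chord[OF that] chord[OF that]] by simp
  have s_eq: "s = (norm (f i - l))\<^sup>2 - (norm (f i))\<^sup>2" if "((l, s), f) \<in> conf" for l s f i
    using chord[OF that, of i] by (auto simp: chords_def)
  have "chord_sum w X \<tau> ^ CARD('d) = (\<Sum>f\<in>PiE UNIV (\<lambda>_. chords X \<tau>). weight (\<tau>, f))" for \<tau>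
    unfolding chord_sum_def power_sum_eq_sum_tuples[OF fin] by (simp add: weight_def split_beta)
  then have "(\<Sum>\<tau>\<in>F. chord_sum w X \<tau> ^ CARD('d)) = (\<Sum>p\<in>conf. weight p)"
    unfolding conf_def using assms(2) fin by (simp add: sum.Sigma finite_PiE case_prod_eta)
  also have "\<dots> \<le> (\<Sum>p\<in>conf. \<Sum>i\<in>UNIV. if p \<in> dep i then (P (G i p) + P (G' i p)) / 2 else 0)"
  proof (rule sum_mono)
    fix p assume "p \<in> conf"
    then obtain l s f where p: "p = ((l, s), f)" and conf: "((l, s), f) \<in> conf" by (metis prod.exhaust)
    have "l \<noteq> 0" using conf nz[of "(l, s)"] by (simp add: conf_def)
    moreover have "v \<bullet> l = 0"
      using v[OF in_X(1)[OF conf, of undefined] in_X(2)[OF conf, of undefined]] by simp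
    ultimately obtain i where i: "f i \<in> affine hull (f ` (UNIV - {i}))"
      using exists_dependent_index[of l v f] \<open>v \<noteq> 0\<close> perp[OF conf] v in_X(1)[OF conf] by metis
    define A where "A = (\<Prod>j\<in>UNIV. w (G i p j))"
    define B where "B = (\<Prod>j\<in>UNIV. w (G' i p j))"
    have "weight p = (\<Prod>j\<in>UNIV. w (G i p j) * w (G' i p j))"
      by (simp add: weight_def G_def G'_def p) (rule prod.cong, auto)
    then have "weight p = A * B"
      by (simp add: A_def B_def prod.distrib)
    also have "\<dots> \<le> (A\<^sup>2 + B\<^sup>2) / 2" using sum_squares_bound[of A B] by simp
    also have "\<dots> = (P (G i p) + P (G' i p)) / 2" by (simp add: P_def A_def B_def prod_power_distrib)
    also have "\<dots> = (if p \<in> dep i then (P (G i p) + P (G' i p)) / 2 else 0)"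
      using i conf by (simp add: dep_def p)
    also have "\<dots> \<le> (\<Sum>i\<in>UNIV. if p \<in> dep i then (P (G i p) + P (G' i p)) / 2 else 0)"
      by (rule member_le_sum) (auto simp: P_def prod_nonneg)
    finally show "weight p \<le> \<dots>" .
  qed
  also have "\<dots> = (\<Sum>i\<in>UNIV. \<Sum>p\<in>dep i. (P (G i p) + P (G' i p)) / 2)"
    using \<open>finite conf\<close> by (subst sum.swap) (auto simp: dep_def sum.inter_filter intro!: sum.cong)
  also have "\<dots> \<le> (\<Sum>i\<in>(UNIV :: 'd set). \<Sum>g\<in>?T. P g)"
  proof (rule sum_mono)
    fix i :: 'd
    have "inj_on (G i) (dep i)"
    proof (rule inj_onI)
      fix p q assume p: "p \<in> dep i" and q: "q \<in> dep i" and eq: "G i p = G i q"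
      obtain l s f where p': "p = ((l, s), f)" by (metis prod.exhaust)
      obtain l' s' f' where q': "q = ((l', s'), f')" by (metis prod.exhaust)
      have c: "((l, s), f) \<in> conf" "((l', s'), f') \<in> conf" using p q by (auto simp: dep_def p' q')
      have "l = l' \<and> f = f'"
        using p q eq perp[OF c(1)] perp[OF c(2)]
        by (intro foot_of_perpendicular_unique) (auto simp: dep_def p' q' G_def)
      then show "p = q" using s_eq[OF c(1)] s_eq[OF c(2)] p' q' by simp
    qed
    moreover have "G i ` dep i \<subseteq> ?T" using in_X by (fastforce simp: dep_def G_def PiE_iff)
    ultimately have 1: "(\<Sum>p\<in>dep i. P (G i p)) \<le> (\<Sum>g\<in>?T. P g)"
      using finT by (intro sum_inj_le) (auto simp: P_def prod_nonneg)
    \<comment> \<open>The end points form a tuple of chords with difference \<open>- l\<close>, with the same affine dependency.\<close>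
    have "inj_on (G' i) (dep i)"
    proof (rule inj_onI)
      fix p q assume p: "p \<in> dep i" and q: "q \<in> dep i" and eq: "G' i p = G' i q"
      obtain l s f where p': "p = ((l, s), f)" by (metis prod.exhaust)
      obtain l' s' f' where q': "q = ((l', s'), f')" by (metis prod.exhaust)
      have c: "((l, s), f) \<in> conf" "((l', s'), f') \<in> conf" using p q by (auto simp: dep_def p' q')
      have shift: "f i - l \<in> affine hull ((\<lambda>j. f j - l) ` (UNIV - {i}))"
        if "f i \<in> affine hull (f ` (UNIV - {i}))" for f :: "'d \<Rightarrow> real ^ 'd" and l
      proof -
        have "- l + f i \<in> (+) (- l) ` (affine hull (f ` (UNIV - {i})))"
          using that by blast
        then have "- l + f i \<in> affine hull ((+) (- l) ` f ` (UNIV - {i}))"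
          by (simp only: affine_hull_translation)
        then show ?thesis by (simp add: image_image)
      qed
      have "- l = - l' \<and> (\<lambda>j. f j - l) = (\<lambda>j. f' j - l')"
      proof (rule foot_of_perpendicular_unique[where i = i])
        show "f i - l \<in> affine hull ((\<lambda>j. f j - l) ` (UNIV - {i}))"
          using p by (intro shift) (simp add: dep_def p')
        show "f' i - l' \<in> affine hull ((\<lambda>j. f' j - l') ` (UNIV - {i}))"
          using q by (intro shift) (simp add: dep_def q')
      qed (use eq perp[OF c(1)] perp[OF c(2)] in \<open>simp_all add: p' q' G'_def\<close>)
      then have "l = l'" "f = f'" by (auto simp: fun_eq_iff)
      then show "p = q" using s_eq[OF c(1)] s_eq[OF c(2)] p' q' by simp
    qed
    moreover have "G' i ` dep i \<subseteq> ?T" using in_X by (fastforce simp: dep_def G'_def PiE_iff)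
    ultimately have "(\<Sum>p\<in>dep i. P (G' i p)) \<le> (\<Sum>g\<in>?T. P g)"
      using finT by (intro sum_inj_le) (auto simp: P_def prod_nonneg)
    with 1 show "(\<Sum>p\<in>dep i. (P (G i p) + P (G' i p)) / 2) \<le> (\<Sum>g\<in>?T. P g)"
      by (simp add: sum.distrib flip: sum_divide_distrib)
  qed
  also have "\<dots> = CARD('d) * (\<Sum>x\<in>X. (w x)\<^sup>2) ^ CARD('d)"
    using assms(1) by (simp add: power_sum_eq_sum_tuples P_def)
  finally show ?thesis .
qed

section \<open>Chords far from the origin\<close>

lemma chord_sum_nonneg: "(\<And>k. k \<in> K \<Longrightarrow> 0 \<le> w k) \<Longrightarrow> 0 \<le> chord_sum w K \<tau>"
  unfolding chord_sum_def by (intro sum_nonneg) (auto simp: chords_def)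

lemma convex_on_nonneg_power: "convex_on {0::real..} (\<lambda>x. x ^ n)"
  using convex_power_odd convex_power_even convex_on_subset by (cases "even n") blast+

text \<open>
  The far points are partitioned into classes by the components of the resonance graph. A chord sum is
  the sum of the chord sums of the classes, and Jensen's inequality for the \<open>d\<close>-th power, with weights
  proportional to the mass of each class, makes the bounds for the classes add up to the same bound for the
  total mass.
\<close>

lemma far_chord_bound:
  fixes F :: "((real ^ 'd::finite) \<times> real) set"
  assumes "finite F" and nz: "\<And>\<tau>. \<tau> \<in> F \<Longrightarrow> fst \<tau> \<noteq> 0"
  shows "\<exists>R. \<forall>K (w :: real ^ 'd \<Rightarrow> real). finite K \<longrightarrow> (\<forall>k\<in>K. norm k > R) \<longrightarrow> (\<forall>k. 0 \<le> w k) \<longrightarrow>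
           (\<Sum>\<tau>\<in>F. chord_sum w K \<tau> ^ CARD('d)) \<le> CARD('d) * (\<Sum>k\<in>K. (w k)\<^sup>2) ^ CARD('d)"
proof -
  define L where "L = fst ` F"
  \<comment> \<open>By \<open>inner_chord\<close> this is large enough for every chord to be a step.\<close>
  define M where "M = (\<Sum>\<tau>\<in>F. (norm (fst \<tau>))\<^sup>2 + \<bar>snd \<tau>\<bar>)"
  define S where "S = (resonant_steps L M)\<^sup>*"
  obtain R where R: "norm k > R \<Longrightarrow> \<exists>v. v \<noteq> 0 \<and> (\<forall>y. (k, y) \<in> S \<longrightarrow> v \<bullet> (y - k) = 0)" for k
    using far_walks_degenerate[of L M] assms(1) by (auto simp: L_def S_def)
  have chord_S: "(k, k - fst \<tau>) \<in> S" if "\<tau> \<in> F" "k \<in> chords K \<tau>" for \<tau> k K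
  proof -
    have "(norm (fst \<tau>))\<^sup>2 + \<bar>snd \<tau>\<bar> \<le> M"
      unfolding M_def using assms(1) that(1) by (intro member_le_sum) auto
    then have "\<bar>k \<bullet> fst \<tau>\<bar> \<le> M" "\<bar>(k - fst \<tau>) \<bullet> fst \<tau>\<bar> \<le> M"
      using inner_chord[OF that(2)] zero_le_power2[of "norm (fst \<tau>)"] by linarith+
    then show ?thesis
      using that(1) by (auto simp: S_def L_def resonant_steps_def intro!: r_into_rtrancl)
  qed
  show ?thesis
  proof (rule exI[of _ R], intro allI impI)
    fix K :: "(real ^ 'd) set" and w :: "real ^ 'd \<Rightarrow> real"
    assume K: "finite K" and far: "\<forall>k\<in>K. norm k > R" and w: "\<forall>k. 0 \<le> w k"
    define cl where "cl k = {y\<in>K. (k, y) \<in> S}" for k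
    define Q where "Q = cl ` K"
    define a where "a X = (\<Sum>k\<in>X. (w k)\<^sup>2)" for X
    have "finite Q" using K by (simp add: Q_def)
    have symS: "(y, x) \<in> S" if "(x, y) \<in> S" for x y
      using that sym_walks[of L M] by (auto simp: S_def dest: symD)
    have transS: "(x, z) \<in> S" if "(x, y) \<in> S" "(y, z) \<in> S" for x y z
      using that by (auto simp: S_def)
    have reflS: "(x, x) \<in> S" for x by (simp add: S_def)
    have cl_eq: "cl x = cl y" if "(x, y) \<in> S" for x y
    proof -
      have "(x, z) \<in> S \<longleftrightarrow> (y, z) \<in> S" for z using that symS transS by blast
      then show ?thesis by (simp add: cl_def)
    qed
    have in_class: "k \<in> X \<longleftrightarrow> k \<in> K \<and> cl k = X" if "X \<in> Q" for k X
    proof -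
      from that obtain k0 where X: "X = cl k0" by (auto simp: Q_def)
      have "(k0, k) \<in> S" if "cl k = cl k0" "k \<in> K"
        using reflS[of k] that by (auto simp: cl_def)
      then show ?thesis unfolding X using cl_eq[of k0 k] by (auto simp: cl_def[of k0])
    qed
    have class_subset: "X \<subseteq> K" if "X \<in> Q" for X using in_class[OF that] by blast
    have class_bound: "(\<Sum>\<tau>\<in>F. chord_sum w X \<tau> ^ CARD('d)) \<le> CARD('d) * a X ^ CARD('d)" if "X \<in> Q" for X
    proof -
      from that obtain k0 where k0: "k0 \<in> K" and X: "X = cl k0" by (auto simp: Q_def)
      obtain v where v: "v \<noteq> 0" "\<And>y. (k0, y) \<in> S \<Longrightarrow> v \<bullet> (y - k0) = 0"
        using R[of k0] far k0 by blast
      have "v \<bullet> (x - y) = 0" if "x \<in> X" "y \<in> X" for x y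
        using v(2)[of x] v(2)[of y] that by (simp add: X cl_def inner_diff_right)
      then show ?thesis
        unfolding a_def using K assms v(1)
        by (intro degenerate_chord_bound[where v = v]) (auto simp: X cl_def)
    qed
    have mass: "(\<Sum>k\<in>K. (w k)\<^sup>2) = (\<Sum>X\<in>Q. a X)"
    proof -
      have "(\<Sum>k\<in>K. (w k)\<^sup>2) = (\<Sum>X\<in>Q. \<Sum>k\<in>{k\<in>K. cl k = X}. (w k)\<^sup>2)"
        using K \<open>finite Q\<close> by (intro sum.group[symmetric]) (auto simp: Q_def)
      also have "\<dots> = (\<Sum>X\<in>Q. a X)"
        unfolding a_def by (intro sum.cong refl) (use in_class in auto)
      finally show ?thesis .
    qed
    have split: "chord_sum w K \<tau> = (\<Sum>X\<in>Q. chord_sum w X \<tau>)" if "\<tau> \<in> F" for \<tau>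
    proof -
      have "chord_sum w K \<tau> = (\<Sum>X\<in>Q. \<Sum>k\<in>{k\<in>chords K \<tau>. cl k = X}. w k * w (k - fst \<tau>))"
        unfolding chord_sum_def using K \<open>finite Q\<close>
        by (intro sum.group[symmetric]) (auto simp: Q_def chords_def)
      also have "\<dots> = (\<Sum>X\<in>Q. chord_sum w X \<tau>)"
        unfolding chord_sum_def
      proof (intro sum.cong refl)
        fix X assume "X \<in> Q"
        show "{k\<in>chords K \<tau>. cl k = X} = chords X \<tau>"
          using in_class[OF \<open>X \<in> Q\<close>] cl_eq[OF chord_S[OF that]] by (auto simp: chords_def)
      qed
      finally show ?thesis .
    qed
    define T where "T = (\<Sum>X\<in>Q. a X)"
    have a_nonneg: "0 \<le> a X" for X by (simp add: a_def sum_nonneg)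
    have c_nonneg: "0 \<le> chord_sum w X \<tau>" for X \<tau> using w by (intro chord_sum_nonneg) auto
    have massless: "chord_sum w X \<tau> = 0" if "X \<in> Q" "a X = 0" for X \<tau>
    proof -
      have "finite X" using class_subset[OF that(1)] K finite_subset by blast
      then have "\<forall>k\<in>X. w k = 0" using that(2) by (simp add: a_def sum_nonneg_eq_0_iff)
      then show ?thesis by (simp add: chord_sum_def chords_def)
    qed
    show "(\<Sum>\<tau>\<in>F. chord_sum w K \<tau> ^ CARD('d)) \<le> CARD('d) * (\<Sum>k\<in>K. (w k)\<^sup>2) ^ CARD('d)"
    proof (cases "T = 0")
      case True
      then have "\<forall>X\<in>Q. a X = 0"
        using \<open>finite Q\<close> a_nonneg by (simp add: T_def sum_nonneg_eq_0_iff)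
      then show ?thesis using split massless by (simp add: mass zero_power)
    next
      case False
      then have "T > 0" using sum_nonneg[of Q a] a_nonneg by (simp add: T_def less_le)
      have jensen: "chord_sum w K \<tau> ^ CARD('d)
          \<le> (\<Sum>X\<in>Q. a X / T * (T / a X) ^ CARD('d) * chord_sum w X \<tau> ^ CARD('d))" if "\<tau> \<in> F" for \<tau>
      proof -
        have "chord_sum w K \<tau> = (\<Sum>X\<in>Q. (a X / T) *\<^sub>R (T / a X * chord_sum w X \<tau>))"
          unfolding split[OF that] using massless False by (intro sum.cong refl) auto
        also have "\<dots> ^ CARD('d) \<le> (\<Sum>X\<in>Q. a X / T * (T / a X * chord_sum w X \<tau>) ^ CARD('d))"
        proof (rule convex_on_sum[OF \<open>finite Q\<close> _ convex_on_nonneg_power])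
          show "Q \<noteq> {}" using False by (auto simp: T_def)
          show "(\<Sum>X\<in>Q. a X / T) = 1" using False by (simp add: T_def flip: sum_divide_distrib)
        qed (use a_nonneg c_nonneg \<open>T > 0\<close> in auto)
        finally show ?thesis by (simp only: power_mult_distrib mult.assoc)
      qed
      have "(\<Sum>\<tau>\<in>F. chord_sum w K \<tau> ^ CARD('d))
          \<le> (\<Sum>\<tau>\<in>F. \<Sum>X\<in>Q. a X / T * (T / a X) ^ CARD('d) * chord_sum w X \<tau> ^ CARD('d))"
        by (intro sum_mono jensen)
      also have "\<dots> = (\<Sum>X\<in>Q. a X / T * (T / a X) ^ CARD('d) * (\<Sum>\<tau>\<in>F. chord_sum w X \<tau> ^ CARD('d)))"
        by (subst sum.swap) (simp add: sum_distrib_left)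
      also have "\<dots> \<le> (\<Sum>X\<in>Q. a X / T * (T / a X) ^ CARD('d) * (CARD('d) * a X ^ CARD('d)))"
        using a_nonneg \<open>T > 0\<close> class_bound by (intro sum_mono mult_left_mono) auto
      also have "\<dots> \<le> (\<Sum>X\<in>Q. a X / T * (CARD('d) * T ^ CARD('d)))"
      proof (intro sum_mono)
        fix X
        show "a X / T * (T / a X) ^ CARD('d) * (CARD('d) * a X ^ CARD('d)) \<le> a X / T * (CARD('d) * T ^ CARD('d))"
          by (cases "a X = 0") (simp_all add: power_divide mult.commute[of "T ^ _"])
      qed
      also have "\<dots> = CARD('d) * T ^ CARD('d)"
        using False by (simp add: T_def flip: sum_distrib_right sum_divide_distrib)
      finally show ?thesis by (simp add: mass T_def)
    qed
  qed
qed

text \<open>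
  The chords with at least one end in the ball are estimated by the Cauchy-Schwarz inequality.
\<close>

lemma chord_sum_le_far_plus_near:
  fixes K :: "'a::euclidean_space set"
  assumes "finite K" and w: "\<And>k. 0 \<le> w k"
    and near: "(\<Sum>k\<in>{k\<in>K. norm k \<le> R}. (w k)\<^sup>2) \<le> \<epsilon>" and mass: "(\<Sum>k\<in>K. (w k)\<^sup>2) \<le> B"
  shows "chord_sum w K \<tau> \<le> chord_sum w {k\<in>K. R < norm k} \<tau> + 2 * (sqrt \<epsilon> * sqrt B)"
proof -
  let ?t = "\<lambda>k. w k * w (k - fst \<tau>)"
  let ?N = "{k\<in>K. norm k \<le> R}"
  let ?K = "chords {k\<in>K. R < norm k} \<tau>"
  let ?A = "{k\<in>chords K \<tau>. norm k \<le> R}"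
  let ?B = "{k\<in>chords K \<tau>. norm (k - fst \<tau>) \<le> R}"
  have fin: "finite (chords J \<tau>)" if "finite J" for J using that by (simp add: chords_def)
  have CS: "(\<Sum>k\<in>C. w (f k) * w (g k)) \<le> sqrt \<epsilon> * sqrt B"
    if "finite C" "inj_on f C" "inj_on g C" "f ` C \<subseteq> ?N" "g ` C \<subseteq> K" for C f g
  proof -
    have f: "(\<Sum>k\<in>C. (w (f k))\<^sup>2) \<le> \<epsilon>" and "(\<Sum>k\<in>C. (w (g k))\<^sup>2) \<le> B"
      using sum_inj_le[of f C ?N "\<lambda>k. (w k)\<^sup>2"] sum_inj_le[of g C K "\<lambda>k. (w k)\<^sup>2"] that near mass assms(1)
      by auto
    then have "L2_set (\<lambda>k. w (f k)) C * L2_set (\<lambda>k. w (g k)) C \<le> sqrt \<epsilon> * sqrt B"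
      unfolding L2_set_def
      using order_trans[OF sum_nonneg[of C "\<lambda>k. (w (f k))\<^sup>2"] f]
      by (intro mult_mono real_sqrt_le_mono real_sqrt_ge_zero sum_nonneg) auto
    then show ?thesis
      using L2_set_mult_ineq[of "\<lambda>k. w (f k)" "\<lambda>k. w (g k)" C] w by simp
  qed
  have A: "sum ?t ?A \<le> sqrt \<epsilon> * sqrt B"
    using assms(1) by (intro CS) (auto simp: inj_on_def chords_def)
  have "(\<Sum>k\<in>?B. w (k - fst \<tau>) * w k) \<le> sqrt \<epsilon> * sqrt B"
    using assms(1) by (intro CS) (auto simp: inj_on_def chords_def)
  then have B: "sum ?t ?B \<le> sqrt \<epsilon> * sqrt B" by (simp add: mult.commute)
  have "chord_sum w K \<tau> \<le> sum ?t (?K \<union> (?A \<union> ?B))"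
    unfolding chord_sum_def using assms(1) w fin by (intro sum_mono2) (auto simp: chords_def)
  also have "\<dots> \<le> sum ?t ?K + sum ?t (?A \<union> ?B)"
    using assms(1) w fin by (subst sum.union_inter[symmetric]) (auto simp: intro!: sum_nonneg)
  also have "sum ?t (?A \<union> ?B) \<le> sum ?t ?A + sum ?t ?B"
    using assms(1) w fin by (subst sum.union_inter[symmetric]) (auto simp: intro!: sum_nonneg)
  finally show ?thesis using A B by (simp add: chord_sum_def)
qed

section \<open>Characters on the torus and on the circle\<close>

lemma cell_borel: "{x::real ^ 'd. \<forall>i. 0 \<le> x $ i \<and> x $ i < 2 * pi} \<in> sets borel"
proof -
  have "{x::real ^ 'd. \<forall>i. 0 \<le> x $ i \<and> x $ i < 2 * pi} =
        (\<Inter>i. {x. 0 \<le> x $ i} \<inter> {x. x $ i < 2 * pi})"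
    by auto
  moreover have "{x::real ^ 'd. 0 \<le> x $ i} \<in> sets borel" "{x::real ^ 'd. x $ i < 2 * pi} \<in> sets borel" for i
    by (intro borel_closed borel_open closed_halfspace_component_ge_cart open_halfspace_component_lt_cart)+
  ultimately show ?thesis by (auto intro!: sets.finite_INT)
qed

lemma finite_measure_torus: "finite_measure (torus :: (real ^ 'd) measure)"
proof (rule finite_measureI)
  let ?C = "{x::real ^ 'd. \<forall>i. 0 \<le> x $ i \<and> x $ i < 2 * pi}"
  have "?C \<subseteq> cbox 0 (\<chi> i. 2 * pi)" by (auto simp: mem_box_cart less_imp_le)
  then have "emeasure lborel ?C \<le> emeasure lborel (cbox (0 :: real ^ 'd) (\<chi> i. 2 * pi))"
    by (rule emeasure_mono) simp
  also have "\<dots> < \<infinity>" by (intro emeasure_bounded_finite bounded_cbox)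
  finally have "emeasure lborel ?C \<noteq> \<infinity>" by simp
  then show "emeasure (torus :: (real ^ 'd) measure) (space torus) \<noteq> \<infinity>"
    using cell_borel by (simp add: torus_def space_restrict_space emeasure_restrict_space)
qed

lemma finite_measure_circle: "finite_measure circle"
  by (rule finite_measureI) (simp add: circle_def space_restrict_space emeasure_restrict_space)

lemma measurable_cis_mult [measurable]: "(\<lambda>t. cis (c * t)) \<in> borel_measurable borel"
  by (intro borel_measurable_continuous_onI continuous_intros)

interpretation torus: finite_measure torus by (rule finite_measure_torus)
interpretation circle: finite_measure circle by (rule finite_measure_circle)
interpretation torus_circle: pair_sigma_finite torus circle ..

lemma measurable_torus: "f \<in> borel_measurable borel \<Longrightarrow> f \<in> borel_measurable torus"
  unfolding torus_def by (intro measurable_restrict_space1) simp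

lemma measurable_circle: "f \<in> borel_measurable borel \<Longrightarrow> f \<in> borel_measurable circle"
  unfolding circle_def by (intro measurable_restrict_space1) simp

lemma measurable_character_torus [measurable]: "(\<lambda>x. cis (y \<bullet> x - c)) \<in> borel_measurable torus"
  by (intro measurable_torus borel_measurable_continuous_onI continuous_intros)

lemma measurable_character_circle [measurable]: "(\<lambda>t. cis (c * t)) \<in> borel_measurable circle"
  by (intro measurable_circle borel_measurable_continuous_onI continuous_intros)

lemma cis_sum: "cis (sum f A) = (\<Prod>x\<in>A. cis (f x))"
  by (induction A rule: infinite_finite_induct) (simp_all add: cis_mult[symmetric])

lemma integral_character_interval:
  "(\<integral>t. indicator {0..<2 * pi} t *\<^sub>R cis (of_int j * t) \<partial>lborel) = (if j = 0 then 2 * pi else 0)"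
proof -
  have "(\<integral>t. indicator {0..<2 * pi} t *\<^sub>R cis (of_int j * t) \<partial>lborel) =
        (\<integral>t. indicator {0..2 * pi} t *\<^sub>R cis (of_int j * t) \<partial>lborel)"
  proof (rule integral_cong_AE)
    show "AE t in lborel. indicator {0..<2 * pi} t *\<^sub>R cis (of_int j * t) =
            indicator {0..2 * pi} t *\<^sub>R cis (of_int j * t)"
      using AE_lborel_singleton[of "2 * pi"] by eventually_elim (auto split: split_indicator)
  qed measurable
  also have "\<dots> = (if j = 0 then 2 * pi else 0)"
  proof (cases "j = 0")
    case True
    then show ?thesis by (simp add: scaleR_conv_of_real)
  next
    case False
    define F where "F t = cis (of_int j * t) / (\<i> * of_int j)" for t
    have "(\<integral>t. indicator {0..2 * pi} t *\<^sub>R cis (of_int j * t) \<partial>lborel) = F (2 * pi) - F 0"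
    proof (rule integral_FTC_atLeastAtMost)
      show "(F has_vector_derivative cis (of_int j * x)) (at x within {0..2 * pi})" for x
        unfolding F_def has_vector_derivative_complex_iff
        using False
        by (auto intro!: derivative_eq_intros simp: Re_divide Im_divide has_real_derivative_iff_has_vector_derivative[symmetric] power2_eq_square)
    qed (auto intro!: continuous_intros)
    also have "cis (of_int j * (2 * pi)) = 1"
      by (simp add: complex_eq_iff cis.ctr mult.commute[of "of_int j"] mult.assoc)
         (metis cos_int_2pin sin_int_2pin mult.assoc mult.commute)
    then have "F (2 * pi) - F 0 = 0" by (simp add: F_def)
    finally show ?thesis using False by simp
  qed
  finally show ?thesis .
qed

lemma integral_character_circle: "(\<integral>t. cis (of_int j * t) \<partial>circle) = (if j = 0 then 2 * pi else 0)"
  unfolding circle_def using integral_character_interval by (subst integral_restrict_space) auto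

lemma Basis_axis: "(Basis :: (real ^ 'd) set) = range (\<lambda>i. axis i 1)"
  by (auto simp: Basis_vec_def)

text \<open>
  Lebesgue measure is a product measure and the character is a product of characters in the
  coordinates.
\<close>

lemma integral_character_torus:
  fixes k :: "int ^ 'd"
  shows "(\<integral>x. cis (int_vec k \<bullet> x) \<partial>torus) = (if k = 0 then (2 * pi) ^ CARD('d) else 0)"
proof -
  define C where "C = {x::real ^ 'd. \<forall>i. 0 \<le> x $ i \<and> x $ i < 2 * pi}"
  define g where "g b t = indicator {0..<2 * pi} t *\<^sub>R cis ((int_vec k \<bullet> b) * t)" for b and t :: real
  interpret product_sigma_finite "\<lambda>_ :: real ^ 'd. lborel :: real measure" ..
  have [measurable]: "g b \<in> borel_measurable borel" for b
    unfolding g_def by measurable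
  have int_g: "integrable lborel (g b)" for b
  proof -
    have "integrable lborel (\<lambda>t. indicator {0..<2 * pi} t *\<^sub>R (1::real))" by simp
    then show ?thesis
      by (rule Bochner_Integration.integrable_bound) (auto simp: g_def split: split_indicator)
  qed
  have eq: "indicator C x *\<^sub>R cis (int_vec k \<bullet> x) = (\<Prod>b\<in>Basis. g b (x \<bullet> b))" for x
  proof (cases "x \<in> C")
    case True
    then have "x \<bullet> b \<in> {0..<2 * pi}" if "b \<in> Basis" for b
      using that by (auto simp: C_def Basis_axis inner_axis)
    then have "(\<Prod>b\<in>Basis. g b (x \<bullet> b)) = (\<Prod>b\<in>Basis. cis ((int_vec k \<bullet> b) * (x \<bullet> b)))"
      by (intro prod.cong) (auto simp: g_def)
    with True show ?thesis by (simp add: cis_sum[symmetric] euclidean_inner[symmetric])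
  next
    case False
    then obtain i where "x \<bullet> axis i 1 \<notin> {0..<2 * pi}" by (auto simp: C_def inner_axis)
    then have "\<exists>b\<in>Basis. g b (x \<bullet> b) = 0" by (intro bexI[of _ "axis i 1"]) (auto simp: g_def Basis_axis)
    with False show ?thesis by (simp add: prod_zero)
  qed
  have "(\<integral>x. cis (int_vec k \<bullet> x) \<partial>torus) = (\<integral>x. (\<Prod>b\<in>Basis. g b (x \<bullet> b)) \<partial>lborel)"
    unfolding torus_def using cell_borel[where 'd='d]
    by (subst integral_restrict_space) (auto simp: eq[unfolded C_def])
  also have "\<dots> = (\<integral>f. (\<Prod>b\<in>Basis. g b ((\<Sum>b\<in>Basis. f b *\<^sub>R b) \<bullet> b)) \<partial>(\<Pi>\<^sub>M b\<in>(Basis::(real ^ 'd) set). lborel))"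
    by (subst lborel_eq) (rule integral_distr; measurable)
  also have "\<dots> = (\<integral>f. (\<Prod>b\<in>Basis. g b (f b)) \<partial>(\<Pi>\<^sub>M b\<in>(Basis::(real ^ 'd) set). lborel))"
    by (intro Bochner_Integration.integral_cong prod.cong refl) simp
  also have "\<dots> = (\<Prod>b\<in>Basis. integral\<^sup>L lborel (g b))"
    using int_g by (intro product_integral_prod) auto
  also have "\<dots> = (\<Prod>i\<in>UNIV. integral\<^sup>L lborel (g (axis i 1)))"
    unfolding Basis_axis by (subst prod.reindex) (auto simp: inj_on_def axis_eq_axis)
  also have "\<dots> = (\<Prod>i\<in>UNIV. if k $ i = 0 then 2 * pi else 0)"
    unfolding g_def of_real_prod
    by (intro prod.cong) (simp_all add: inner_axis int_vec_def integral_character_interval)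
  also have "\<dots> = (if k = 0 then (2 * pi) ^ CARD('d) else 0)"
    by (auto simp: vec_eq_iff intro!: prod_zero)
  finally show ?thesis .
qed

section \<open>Trigonometric polynomials and Bessel's inequality\<close>

definition trig_poly :: "(int ^ 'd \<Rightarrow> complex) \<Rightarrow> (int ^ 'd) set \<Rightarrow> real ^ 'd \<Rightarrow> complex" where
  "trig_poly e K x = (\<Sum>k\<in>K. e k * cis (int_vec k \<bullet> x))"

lemma measurable_trig_poly [measurable]: "trig_poly e K \<in> borel_measurable torus"
  unfolding trig_poly_def
  by (intro measurable_torus borel_measurable_continuous_onI continuous_intros)

lemma norm_trig_poly_le: "cmod (trig_poly e K x) \<le> (\<Sum>k\<in>K. cmod (e k))"
  unfolding trig_poly_def by (intro sum_norm_le) (simp add: norm_mult)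

lemma integrable_trig_poly_power: "integrable torus (\<lambda>x. (cmod (trig_poly e K x)) ^ n)"
  using norm_trig_poly_le[of e K]
  by (intro torus.integrable_const_bound[where B = "(\<Sum>k\<in>K. cmod (e k)) ^ n"]) (auto intro!: power_mono)

lemma integrable_character [simp]: "integrable torus (\<lambda>x. cis (y \<bullet> x))"
  using measurable_character_torus[of y 0] by (intro torus.integrable_const_bound[where B = 1]) auto

lemma int_vec_diff: "int_vec (k - l) = int_vec k - int_vec l"
  by (simp add: int_vec_def vec_eq_iff)

lemma trig_poly_density_coeff:
  fixes l :: "int ^ 'd"
  shows "(\<integral>x. cis (- (int_vec l \<bullet> x)) * of_real ((cmod (trig_poly e K x))\<^sup>2) \<partial>torus) =
    (2 * pi) ^ CARD('d) * (\<Sum>k\<in>K. \<Sum>k'\<in>K. if k - k' = l then e k * cnj (e k') else 0)"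
proof -
  have "cis (- (int_vec l \<bullet> x)) * of_real ((cmod (trig_poly e K x))\<^sup>2) =
      (\<Sum>k\<in>K. \<Sum>k'\<in>K. e k * cnj (e k') * cis (int_vec (k - k' - l) \<bullet> x))" for x :: "real ^ 'd"
  proof -
    have "cis (- (int_vec l \<bullet> x)) * (e k * cis (int_vec k \<bullet> x) * cnj (e k' * cis (int_vec k' \<bullet> x))) =
        e k * cnj (e k') * cis (int_vec (k - k' - l) \<bullet> x)" for k k'
    proof -
      have "cis (int_vec (k - k' - l) \<bullet> x) =
          cis (int_vec k \<bullet> x) * cis (- (int_vec k' \<bullet> x)) * cis (- (int_vec l \<bullet> x))"
        by (simp add: int_vec_diff inner_diff_left cis_mult)
      then show ?thesis by (simp add: cis_cnj)
    qed
    moreover have "complex_of_real ((cmod (trig_poly e K x))\<^sup>2) =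
        (\<Sum>k\<in>K. \<Sum>k'\<in>K. e k * cis (int_vec k \<bullet> x) * cnj (e k' * cis (int_vec k' \<bullet> x)))"
      by (simp only: complex_norm_square trig_poly_def cnj_sum sum_product)
    ultimately show ?thesis by (simp only: sum_distrib_left)
  qed
  then have "(\<integral>x. cis (- (int_vec l \<bullet> x)) * of_real ((cmod (trig_poly e K x))\<^sup>2) \<partial>torus) =
      (\<Sum>k\<in>K. \<Sum>k'\<in>K. e k * cnj (e k') * (\<integral>x. cis (int_vec (k - k' - l) \<bullet> x) \<partial>torus))"
    by (simp add: Bochner_Integration.integral_sum)
  also have "\<dots> = (\<Sum>k\<in>K. \<Sum>k'\<in>K. (2 * pi) ^ CARD('d) * (if k - k' = l then e k * cnj (e k') else 0))"
    by (intro sum.cong refl) (simp add: integral_character_torus)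
  finally show ?thesis by (simp add: sum_distrib_left)
qed

lemma trig_poly_parseval:
  fixes e :: "int ^ 'd \<Rightarrow> complex"
  assumes "finite K"
  shows "(\<integral>x. (cmod (trig_poly e K x))\<^sup>2 \<partial>torus) = (2 * pi) ^ CARD('d) * (\<Sum>k\<in>K. (cmod (e k))\<^sup>2)"
proof -
  have "complex_of_real (\<integral>x. (cmod (trig_poly e K x))\<^sup>2 \<partial>torus) =
      (\<integral>x. cis (- (int_vec 0 \<bullet> x)) * of_real ((cmod (trig_poly e K x))\<^sup>2) \<partial>torus)"
    by (simp add: int_vec_def zero_vec_def[symmetric] del: of_real_power)
  also have "\<dots> = (2 * pi) ^ CARD('d) * (\<Sum>k\<in>K. e k * cnj (e k))"
    unfolding trig_poly_density_coeff using assms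
    by (simp add: sum.delta)
  also have "\<dots> = complex_of_real ((2 * pi) ^ CARD('d) * (\<Sum>k\<in>K. (cmod (e k))\<^sup>2))"
    by (simp add: complex_norm_square del: of_real_power)
  finally show ?thesis by (simp only: of_real_eq_iff)
qed

lemma integrable_L2_torus:
  assumes "u \<in> L2_torus"
  shows "integrable torus u"
proof -
  have [measurable]: "u \<in> borel_measurable torus" and "integrable torus (\<lambda>x. (cmod (u x))\<^sup>2)"
    using assms by (auto simp: L2_torus_def)
  then have "integrable torus (\<lambda>x. 1 + (cmod (u x))\<^sup>2)" by simp
  then show ?thesis
  proof (rule Bochner_Integration.integrable_bound)
    have "cmod z \<le> 1 + (cmod z)\<^sup>2" for z
    proof -
      have "0 \<le> (cmod z - 1)\<^sup>2 + (cmod z)\<^sup>2 + 1" by (intro add_nonneg_nonneg) auto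
      then show ?thesis by (simp add: power2_eq_square algebra_simps)
    qed
    then show "AE x in torus. norm (u x) \<le> norm (1 + (cmod (u x))\<^sup>2)" by simp
  qed simp
qed

lemma bessel_torus:
  fixes u :: "real ^ 'd \<Rightarrow> complex"
  assumes u: "u \<in> L2_torus" and "finite K"
  shows "(2 * pi) ^ CARD('d) * (\<Sum>k\<in>K. (cmod (fourier_coeff u k))\<^sup>2) \<le> (L2_norm_torus u)\<^sup>2"
proof -
  let ?e = "fourier_coeff u"
  let ?S = "trig_poly ?e K"
  let ?m = "(2 * pi) ^ CARD('d) * (\<Sum>k\<in>K. (cmod (?e k))\<^sup>2)"
  have [measurable]: "u \<in> borel_measurable torus" and u2: "integrable torus (\<lambda>x. (cmod (u x))\<^sup>2)"
    using u by (auto simp: L2_torus_def)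
  have intc: "integrable torus (\<lambda>x. u x * cis (- (int_vec k \<bullet> x)))" for k
    using measurable_character_torus[of "- int_vec k" 0]
    by (intro Bochner_Integration.integrable_bound[OF integrable_L2_torus[OF u]]) (auto simp: norm_mult)
  have expand: "u x * cnj (?S x) = (\<Sum>k\<in>K. cnj (?e k) * (u x * cis (- (int_vec k \<bullet> x))))" for x
    by (simp add: trig_poly_def cnj_sum cis_cnj sum_distrib_left mult_ac)
  have int_uS: "integrable torus (\<lambda>x. u x * cnj (?S x))"
    unfolding expand using intc by (intro Bochner_Integration.integrable_sum integrable_mult_right) auto
  have "(\<integral>x. u x * cnj (?S x) \<partial>torus) = (\<Sum>k\<in>K. cnj (?e k) * ((2 * pi) ^ CARD('d) * ?e k))"
    unfolding expand using intc by (simp add: Bochner_Integration.integral_sum fourier_coeff_def)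
  also have "\<dots> = of_real ?m"
    by (simp add: complex_norm_square sum_distrib_left mult_ac del: of_real_power)
  finally have "Re (\<integral>x. u x * cnj (?S x) \<partial>torus) = ?m" by simp
  moreover define f where "f x = Re (u x * cnj (?S x))" for x
  ultimately have f: "integrable torus f" "(\<integral>x. f x \<partial>torus) = ?m"
    using integral_Re[OF int_uS] integrable_Re[OF int_uS] unfolding f_def by simp_all
  have "0 \<le> (\<integral>x. (cmod (u x))\<^sup>2 - 2 * f x + (cmod (?S x))\<^sup>2 \<partial>torus)"
  proof (rule integral_nonneg_AE, rule AE_I2)
    fix x
    have "0 \<le> (cmod (u x - ?S x))\<^sup>2" by simp
    also have "\<dots> = (cmod (u x))\<^sup>2 - 2 * f x + (cmod (?S x))\<^sup>2"
      unfolding f_def by (simp only: cmod_power2) (simp add: power2_eq_square algebra_simps)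
    finally show "0 \<le> \<dots>" .
  qed
  also have "\<dots> = (\<integral>x. (cmod (u x))\<^sup>2 \<partial>torus) - 2 * ?m + ?m"
    using u2 f integrable_trig_poly_power[of ?e K 2] trig_poly_parseval[OF assms(2), of ?e]
    by simp
  finally show ?thesis by (simp add: L2_norm_torus_def mult_ac)
qed

section \<open>The position density of the evolution\<close>

text \<open>
  The Fourier coefficients at time \<open>t\<close> of the solution with initial coefficients \<open>e\<close>.
\<close>

definition evolved :: "(int ^ 'd \<Rightarrow> complex) \<Rightarrow> real \<Rightarrow> int ^ 'd \<Rightarrow> complex" where
  "evolved e t k = e k * cis (- ((norm (int_vec k))\<^sup>2 * t))"

text \<open>
  The space-time Fourier coefficient at \<open>(l, s)\<close> of the position density of a solution whose initial
  datum has the coefficients \<open>e\<close>, cut off to the frequencies in \<open>K\<close>.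
\<close>

definition density_coeff :: "(int ^ 'd \<Rightarrow> complex) \<Rightarrow> (int ^ 'd) set \<Rightarrow> int ^ 'd \<Rightarrow> int \<Rightarrow> complex" where
  "density_coeff e K l s = (\<Sum>k\<in>K. \<Sum>k'\<in>K.
     if k - k' = l \<and> (norm (int_vec k'))\<^sup>2 - (norm (int_vec k))\<^sup>2 = of_int s
     then e k * cnj (e k') else 0)"

lemma norm_int_vec_sq: "(norm (int_vec k))\<^sup>2 = of_int (\<Sum>i\<in>UNIV. (k $ i)\<^sup>2)"
  unfolding power2_norm_eq_inner inner_vec_def int_vec_def by (simp add: power2_eq_square)

lemma trig_poly_evolved:
  "trig_poly (evolved e t) K x = (\<Sum>k\<in>K. e k * cis (int_vec k \<bullet> x - (norm (int_vec k))\<^sup>2 * t))"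
  by (simp add: trig_poly_def evolved_def cis_mult mult.assoc)

lemma integrable_cis_circle: "integrable circle (\<lambda>t. cis (c * t))"
  by (intro circle.integrable_const_bound[where B = 1]) auto

lemma integral_trig_poly_density:
  fixes l :: "int ^ 'd"
  shows "(\<integral>t. cis (- (of_int s * t)) *
       (\<integral>x. cis (- (int_vec l \<bullet> x)) * of_real ((cmod (trig_poly (evolved e t) K x))\<^sup>2) \<partial>torus) \<partial>circle) =
     (2 * pi) ^ (CARD('d) + 1) * density_coeff e K l s"
proof -
  define q :: "int ^ 'd \<Rightarrow> int" where "q k = (\<Sum>i\<in>UNIV. (k $ i)\<^sup>2)" for k
  have q: "(norm (int_vec k))\<^sup>2 = of_int (q k)" for k :: "int ^ 'd"
    by (simp add: norm_int_vec_sq q_def)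
  have phase: "cis (- (of_int s * t)) * (evolved e t k * cnj (evolved e t k')) =
      e k * cnj (e k') * cis (of_int (q k' - q k - s) * t)" for t k k'
  proof -
    have "cis (of_int (q k' - q k - s) * t) =
        cis (- (of_int s * t)) * (cis (- (of_int (q k) * t)) * cis (of_int (q k') * t))"
      by (simp add: cis_mult algebra_simps)
    then show ?thesis by (simp add: evolved_def q cis_cnj)
  qed
  have "cis (- (of_int s * t)) *
      (\<integral>x. cis (- (int_vec l \<bullet> x)) * of_real ((cmod (trig_poly (evolved e t) K x))\<^sup>2) \<partial>torus) =
      (\<Sum>k\<in>K. \<Sum>k'\<in>K. (2 * pi) ^ CARD('d) * (if k - k' = l then e k * cnj (e k') else 0) *
         cis (of_int (q k' - q k - s) * t))" for t
  proof -
    have coeff: "cis (- (of_int s * t)) * (P * (if k - k' = l then evolved e t k * cnj (evolved e t k') else 0)) =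
        P * (if k - k' = l then e k * cnj (e k') else 0) * cis (of_int (q k' - q k - s) * t)" for k k' and P :: complex
      using phase[of t k k'] by (simp add: mult.assoc mult.left_commute[of _ P])
    then show ?thesis
      unfolding trig_poly_density_coeff sum_distrib_left by (simp only: coeff)
  qed
  then have "(\<integral>t. cis (- (of_int s * t)) *
       (\<integral>x. cis (- (int_vec l \<bullet> x)) * of_real ((cmod (trig_poly (evolved e t) K x))\<^sup>2) \<partial>torus) \<partial>circle) =
     (\<Sum>k\<in>K. \<Sum>k'\<in>K. (2 * pi) ^ CARD('d) * (if k - k' = l then e k * cnj (e k') else 0) *
         (\<integral>t. cis (of_int (q k' - q k - s) * t) \<partial>circle))"
    using integrable_cis_circle by (simp add: Bochner_Integration.integral_sum del: of_int_diff)
  also have "\<dots> = (\<Sum>k\<in>K. \<Sum>k'\<in>K. (2 * pi) ^ (CARD('d) + 1) *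
      (if k - k' = l \<and> (norm (int_vec k'))\<^sup>2 - (norm (int_vec k))\<^sup>2 = of_int s then e k * cnj (e k') else 0))"
  proof (intro sum.cong refl)
    fix k k' :: "int ^ 'd"
    have "(norm (int_vec k'))\<^sup>2 - (norm (int_vec k))\<^sup>2 = real_of_int s \<longleftrightarrow> q k' - q k - s = 0"
      unfolding q by linarith
    then show "complex_of_real ((2 * pi) ^ CARD('d)) * (if k - k' = l then e k * cnj (e k') else 0) *
          (\<integral>t. cis (of_int (q k' - q k - s) * t) \<partial>circle) =
        (2 * pi) ^ (CARD('d) + 1) *
        (if k - k' = l \<and> (norm (int_vec k'))\<^sup>2 - (norm (int_vec k))\<^sup>2 = of_int s then e k * cnj (e k') else 0)"
      unfolding integral_character_circle by simp
  qed
  finally show ?thesis by (simp add: density_coeff_def sum_distrib_left)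
qed

lemma L2_torus_diff:
  assumes "v \<in> L2_torus" "w \<in> L2_torus"
  shows "(\<lambda>x. v x - w x) \<in> L2_torus"
proof -
  have [measurable]: "v \<in> borel_measurable torus" "w \<in> borel_measurable torus"
    and int: "integrable torus (\<lambda>x. 2 * (cmod (v x))\<^sup>2 + 2 * (cmod (w x))\<^sup>2)"
    using assms by (auto simp: L2_torus_def)
  have "(cmod (a - b))\<^sup>2 \<le> 2 * (cmod a)\<^sup>2 + 2 * (cmod b)\<^sup>2" for a b
  proof -
    have "(cmod (a - b))\<^sup>2 \<le> (cmod a + cmod b)\<^sup>2" by (intro power_mono norm_triangle_ineq4) auto
    also have "\<dots> \<le> 2 * (cmod a)\<^sup>2 + 2 * (cmod b)\<^sup>2"
      using zero_le_power2[of "cmod a - cmod b"] by (simp add: power2_eq_square algebra_simps)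
    finally show ?thesis .
  qed
  then have "integrable torus (\<lambda>x. (cmod (v x - w x))\<^sup>2)"
    by (intro Bochner_Integration.integrable_bound[OF int]) auto
  then show ?thesis by (simp add: L2_torus_def)
qed

text \<open>
  From \<open>||a|\<^sup>2 - |b|\<^sup>2| \<le> |b - a| * (|b - a| + 2 * |a|)\<close> and Young's inequality with parameter \<open>\<eta>\<close>.
\<close>

lemma abs_diff_norm_squares_le:
  fixes a b :: complex
  assumes "\<eta> > 0"
  shows "\<bar>(cmod a)\<^sup>2 - (cmod b)\<^sup>2\<bar> \<le> (1 + 1 / \<eta>) * (cmod (b - a))\<^sup>2 + \<eta> * (cmod a)\<^sup>2"
proof -
  define p where "p = cmod (b - a)"
  have ab: "\<bar>cmod a - cmod b\<bar> \<le> p" unfolding p_def by (metis norm_minus_commute norm_triangle_ineq3)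
  have "(cmod a)\<^sup>2 - (cmod b)\<^sup>2 = (cmod a - cmod b) * (cmod a + cmod b)"
    by (simp add: power2_eq_square algebra_simps)
  then have "\<bar>(cmod a)\<^sup>2 - (cmod b)\<^sup>2\<bar> = \<bar>cmod a - cmod b\<bar> * (cmod a + cmod b)"
    by (simp add: abs_mult)
  also have "\<dots> \<le> p * (p + 2 * cmod a)"
    using ab by (intro mult_mono) auto
  also have "\<dots> \<le> (1 + 1 / \<eta>) * p\<^sup>2 + \<eta> * (cmod a)\<^sup>2"
  proof -
    have "0 \<le> (p - \<eta> * cmod a)\<^sup>2 / \<eta>" using assms by simp
    also have "\<dots> = p\<^sup>2 / \<eta> - 2 * p * cmod a + \<eta> * (cmod a)\<^sup>2"
      using assms by (simp add: power2_eq_square field_simps)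
    finally show ?thesis by (simp add: power2_eq_square algebra_simps)
  qed
  finally show ?thesis by (simp add: p_def)
qed

text \<open>
  Let \<open>N m\<close> be the squared distance from \<open>S m\<close> to \<open>v\<close>. Integrating \<open>abs_diff_norm_squares_le\<close>
  with \<open>\<eta>\<close> of the order of the square root of \<open>N m\<close> bounds the difference of the integrals by
  a quantity that tends to \<open>0\<close>.
\<close>

lemma L2_convergence_imp_density_convergence:
  fixes v :: "real ^ 'd \<Rightarrow> complex"
  assumes v: "v \<in> L2_torus" and S: "\<And>m. S m \<in> L2_torus"
    and conv: "(\<lambda>m. L2_norm_torus (\<lambda>x. v x - S m x)) \<longlonglongrightarrow> 0"
    and B: "\<And>m::nat. (\<integral>x. (cmod (S m x))\<^sup>2 \<partial>torus) \<le> B"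
    and c [measurable]: "c \<in> borel_measurable torus" and c1: "\<And>x. cmod (c x) \<le> 1"
  shows "(\<lambda>m. \<integral>x. c x * of_real ((cmod (S m x))\<^sup>2) \<partial>torus) \<longlonglongrightarrow> (\<integral>x. c x * of_real ((cmod (v x))\<^sup>2) \<partial>torus)"
proof -
  have [measurable]: "v \<in> borel_measurable torus" "\<And>m. S m \<in> borel_measurable torus"
    and v2: "integrable torus (\<lambda>x. (cmod (v x))\<^sup>2)" and S2: "\<And>m. integrable torus (\<lambda>x. (cmod (S m x))\<^sup>2)"
    and d2: "\<And>m. integrable torus (\<lambda>x. (cmod (v x - S m x))\<^sup>2)"
    using v S L2_torus_diff[OF v S] by (auto simp: L2_torus_def)
  define N where "N m = (\<integral>x. (cmod (v x - S m x))\<^sup>2 \<partial>torus)" for m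
  \<comment> \<open>The second summand only keeps \<open>\<eta> m\<close> positive when \<open>N m = 0\<close>.\<close>
  define \<eta> where "\<eta> m = sqrt (N m) + 1 / real (Suc m)" for m
  have N_nonneg: "0 \<le> N m" for m by (simp add: N_def)
  have sqrtN: "(\<lambda>m. sqrt (N m)) \<longlonglongrightarrow> 0" using conv by (simp add: L2_norm_torus_def N_def)
  have N0: "N \<longlonglongrightarrow> 0"
    using tendsto_power[OF sqrtN, of 2] N_nonneg by simp
  have \<eta>0: "\<eta> \<longlonglongrightarrow> 0"
    unfolding \<eta>_def using tendsto_add[OF sqrtN LIMSEQ_inverse_real_of_nat] by (simp add: field_simps)
  have \<eta>_pos: "\<eta> m > 0" for m
    unfolding \<eta>_def using N_nonneg[of m] by (intro add_nonneg_pos) auto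
  have int: "integrable torus (\<lambda>x. c x * of_real ((cmod (w x))\<^sup>2))"
    if [measurable]: "w \<in> borel_measurable torus" and "integrable torus (\<lambda>x. (cmod (w x))\<^sup>2)" for w
    using c1 by (intro Bochner_Integration.integrable_bound[OF that(2)]) (auto simp: norm_mult mult_left_le_one_le simp del: of_real_power)
  have bound: "cmod ((\<integral>x. c x * of_real ((cmod (S m x))\<^sup>2) \<partial>torus) - (\<integral>x. c x * of_real ((cmod (v x))\<^sup>2) \<partial>torus))
      \<le> N m + sqrt (N m) + \<eta> m * B" for m
  proof -
    have "cmod ((\<integral>x. c x * of_real ((cmod (S m x))\<^sup>2) \<partial>torus) - (\<integral>x. c x * of_real ((cmod (v x))\<^sup>2) \<partial>torus))
        = cmod (\<integral>x. c x * of_real ((cmod (S m x))\<^sup>2) - c x * of_real ((cmod (v x))\<^sup>2) \<partial>torus)"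
      using int[OF _ S2] int[OF _ v2] by simp
    also have "\<dots> \<le> (\<integral>x. (1 + 1 / \<eta> m) * (cmod (v x - S m x))\<^sup>2 + \<eta> m * (cmod (S m x))\<^sup>2 \<partial>torus)"
    proof (rule Bochner_Integration.integral_norm_bound_integral)
      fix x
      have "cmod (c x * of_real ((cmod (S m x))\<^sup>2) - c x * of_real ((cmod (v x))\<^sup>2))
          = cmod (c x) * \<bar>(cmod (S m x))\<^sup>2 - (cmod (v x))\<^sup>2\<bar>"
        by (simp only: right_diff_distrib[symmetric] norm_mult of_real_diff[symmetric] norm_of_real)
      also have "\<dots> \<le> \<bar>(cmod (S m x))\<^sup>2 - (cmod (v x))\<^sup>2\<bar>"
        using c1 by (intro mult_left_le_one_le) auto
      also have "\<dots> \<le> (1 + 1 / \<eta> m) * (cmod (v x - S m x))\<^sup>2 + \<eta> m * (cmod (S m x))\<^sup>2"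
        by (rule abs_diff_norm_squares_le[OF \<eta>_pos])
      finally show "cmod (c x * of_real ((cmod (S m x))\<^sup>2) - c x * of_real ((cmod (v x))\<^sup>2)) \<le> \<dots>" .
    qed (use int[OF _ S2] int[OF _ v2] S2 d2 in auto)
    also have "\<dots> = (1 + 1 / \<eta> m) * N m + \<eta> m * (\<integral>x. (cmod (S m x))\<^sup>2 \<partial>torus)"
      using S2 d2 by (simp add: N_def)
    also have "\<dots> \<le> (N m + sqrt (N m)) + \<eta> m * B"
    proof (intro add_mono mult_left_mono B less_imp_le[OF \<eta>_pos])
      have "N m = sqrt (N m) * sqrt (N m)" using N_nonneg[of m] by simp
      also have "\<dots> \<le> sqrt (N m) * \<eta> m"
        by (intro mult_left_mono) (auto simp: \<eta>_def N_nonneg)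
      finally have "N m / \<eta> m \<le> sqrt (N m)" using \<eta>_pos[of m] by (simp add: pos_divide_le_eq)
      then show "(1 + 1 / \<eta> m) * N m \<le> N m + sqrt (N m)" by (simp add: distrib_right)
    qed
    finally show ?thesis by simp
  qed
  have "(\<lambda>m. N m + sqrt (N m) + \<eta> m * B) \<longlonglongrightarrow> 0 + 0 + 0 * B"
    by (intro tendsto_intros N0 sqrtN \<eta>0)
  then have "(\<lambda>m. N m + sqrt (N m) + \<eta> m * B) \<longlonglongrightarrow> 0" by simp
  then have "(\<lambda>m. (\<integral>x. c x * of_real ((cmod (S m x))\<^sup>2) \<partial>torus) - (\<integral>x. c x * of_real ((cmod (v x))\<^sup>2) \<partial>torus)) \<longlonglongrightarrow> 0"
    by (rule Lim_null_comparison[rotated]) (simp add: bound del: of_real_power)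
  then show ?thesis by (rule LIM_zero_cancel)
qed

lemma trig_poly_L2: "trig_poly e K \<in> L2_torus"
  using integrable_trig_poly_power[of e K 2] by (simp add: L2_torus_def)

definition exhaustion :: "nat \<Rightarrow> (int ^ 'd) set" where
  "exhaustion m = {k. to_nat k < m}"

lemma finite_exhaustion: "finite (exhaustion m :: (int ^ 'd) set)"
proof -
  have "(exhaustion m :: (int ^ 'd) set) = to_nat -` {..<m}" by (auto simp: exhaustion_def)
  then show ?thesis by (simp add: finite_vimageI inj_to_nat)
qed

lemma filterlim_exhaustion: "filterlim exhaustion (finite_subsets_at_top UNIV) sequentially"
  unfolding filterlim_finite_subsets_at_top
proof (intro allI impI)
  fix X :: "(int ^ 'd) set" assume "finite X \<and> X \<subseteq> UNIV"
  then have "\<forall>k\<in>X. \<forall>\<^sub>F m in sequentially. k \<in> exhaustion m"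
    by (auto simp: exhaustion_def intro: eventually_gt_at_top)
  then have "\<forall>\<^sub>F m in sequentially. \<forall>k\<in>X. k \<in> exhaustion m"
    using \<open>finite X \<and> X \<subseteq> UNIV\<close> by (intro eventually_ball_finite) auto
  then show "\<forall>\<^sub>F m in sequentially. finite (exhaustion m) \<and> X \<subseteq> exhaustion m \<and> exhaustion m \<subseteq> UNIV"
    by eventually_elim (auto simp: finite_exhaustion)
qed

text \<open>
  At each time the densities of the partial sums converge weakly to that of the solution, and by Bessel's
  inequality their masses are bounded uniformly in time and in the partial sum, so dominated convergence
  applies to the integral over the circle.
\<close>

lemma evolution_density:
  fixes u :: "real ^ 'd \<Rightarrow> complex"
  assumes u: "u \<in> L2_torus" and ev: "schroedinger_evolution u \<psi>"
  shows "(\<lambda>m. (2 * pi) ^ (CARD('d) + 1) * density_coeff (fourier_coeff u) (exhaustion m) l s)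
    \<longlonglongrightarrow> (\<integral>(x, t). cis (- (of_int s * t)) * cis (- (int_vec l \<bullet> x)) * of_real ((cmod (\<psi> x t))\<^sup>2)
            \<partial>(torus \<Otimes>\<^sub>M circle))"
proof -
  define e where "e = fourier_coeff u"
  define S where "S m t = trig_poly (evolved e t) (exhaustion m)" for m t
  define B where "B = (L2_norm_torus u)\<^sup>2"
  define c where "c x = cis (- (int_vec l \<bullet> x))" for x :: "real ^ 'd"
  have [measurable]: "case_prod \<psi> \<in> borel_measurable (torus \<Otimes>\<^sub>M circle)"
    using ev by (simp add: schroedinger_evolution_def)
  have [measurable]: "c \<in> borel_measurable torus"
    unfolding c_def by (intro measurable_torus borel_measurable_continuous_onI continuous_intros)
  have c1: "cmod (c x) \<le> 1" for x by (simp add: c_def)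
  have L2: "(\<lambda>x. \<psi> x t) \<in> L2_torus" if "t \<in> space circle" for t
    using ev that by (simp add: schroedinger_evolution_def)
  have conv: "(\<lambda>m. L2_norm_torus (\<lambda>x. \<psi> x t - S m t x)) \<longlonglongrightarrow> 0" if "t \<in> space circle" for t
    using ev that filterlim_compose[OF _ filterlim_exhaustion]
    unfolding schroedinger_evolution_def S_def trig_poly_evolved e_def by blast
  have SB: "(\<integral>x. (cmod (S m t x))\<^sup>2 \<partial>torus) \<le> B" for m t
    using bessel_torus[OF u finite_exhaustion[of m]] trig_poly_parseval[OF finite_exhaustion, of "evolved e t" m]
    by (simp add: S_def B_def e_def evolved_def norm_mult)
  have lim: "(\<lambda>m. \<integral>x. b x * of_real ((cmod (S m t x))\<^sup>2) \<partial>torus) \<longlonglongrightarrow> (\<integral>x. b x * of_real ((cmod (\<psi> x t))\<^sup>2) \<partial>torus)"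
    if "t \<in> space circle" "b \<in> borel_measurable torus" "\<And>x. cmod (b x) \<le> 1" for t and b :: "real ^ 'd \<Rightarrow> complex"
    using L2[OF that(1)] conv[OF that(1)] SB that(2,3)
    by (intro L2_convergence_imp_density_convergence) (auto simp: S_def trig_poly_L2)
  have mass: "(\<integral>x. (cmod (\<psi> x t))\<^sup>2 \<partial>torus) \<le> B" if "t \<in> space circle" for t
  proof -
    have "(\<lambda>m. complex_of_real (\<integral>x. (cmod (S m t x))\<^sup>2 \<partial>torus)) \<longlonglongrightarrow> complex_of_real (\<integral>x. (cmod (\<psi> x t))\<^sup>2 \<partial>torus)"
      using lim[OF that, of "\<lambda>_. 1"] by (simp del: of_real_power)
    then have "(\<lambda>m. \<integral>x. (cmod (S m t x))\<^sup>2 \<partial>torus) \<longlonglongrightarrow> (\<integral>x. (cmod (\<psi> x t))\<^sup>2 \<partial>torus)"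
      by (simp add: tendsto_of_real_iff)
    then show ?thesis by (rule LIMSEQ_le_const2) (use SB in auto)
  qed
  have int: "integrable (torus \<Otimes>\<^sub>M circle) (\<lambda>(x, t). (cmod (\<psi> x t))\<^sup>2)"
  proof (rule integrableI_bounded)
    have "(\<integral>\<^sup>+p. ennreal (norm (case p of (x, t) \<Rightarrow> (cmod (\<psi> x t))\<^sup>2)) \<partial>(torus \<Otimes>\<^sub>M circle))
        = (\<integral>\<^sup>+t. \<integral>\<^sup>+x. ennreal ((cmod (\<psi> x t))\<^sup>2) \<partial>torus \<partial>circle)"
      by (subst torus_circle.nn_integral_snd[symmetric]) (auto simp: split_beta')
    also have "\<dots> \<le> (\<integral>\<^sup>+t. ennreal B \<partial>circle)"
    proof (rule nn_integral_mono)
      fix t assume t: "t \<in> space circle"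
      then have "(\<integral>\<^sup>+x. ennreal ((cmod (\<psi> x t))\<^sup>2) \<partial>torus) = ennreal (\<integral>x. (cmod (\<psi> x t))\<^sup>2 \<partial>torus)"
        using L2[OF t] by (intro nn_integral_eq_integral) (auto simp: L2_torus_def)
      then show "(\<integral>\<^sup>+x. ennreal ((cmod (\<psi> x t))\<^sup>2) \<partial>torus) \<le> ennreal B"
        using mass[OF t] by (simp add: ennreal_leI)
    qed
    also have "\<dots> < \<infinity>"
      using circle.emeasure_finite[of "space circle"] by (simp add: ennreal_mult_eq_top_iff less_top[symmetric])
    finally show "(\<integral>\<^sup>+p. ennreal (norm (case p of (x, t) \<Rightarrow> (cmod (\<psi> x t))\<^sup>2)) \<partial>(torus \<Otimes>\<^sub>M circle)) < \<infinity>" .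
  qed measurable
  have int': "integrable (torus \<Otimes>\<^sub>M circle)
      (\<lambda>(x, t). cis (- (of_int s * t)) * c x * of_real ((cmod (\<psi> x t))\<^sup>2))"
  proof (rule Bochner_Integration.integrable_bound[OF int])
    have "(\<lambda>t. cis (- (of_int s * t))) \<in> borel_measurable circle"
      using measurable_character_circle[of "- of_int s"] by simp
    then show "(\<lambda>(x, t). cis (- (of_int s * t)) * c x * complex_of_real ((cmod (\<psi> x t))\<^sup>2))
        \<in> borel_measurable (torus \<Otimes>\<^sub>M circle)"
      by measurable
  qed (auto simp: norm_mult c_def simp del: of_real_power)
  have eq: "(\<integral>(x, t). cis (- (of_int s * t)) * cis (- (int_vec l \<bullet> x)) * of_real ((cmod (\<psi> x t))\<^sup>2) \<partial>(torus \<Otimes>\<^sub>M circle))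
      = (\<integral>t. cis (- (of_int s * t)) * (\<integral>x. c x * of_real ((cmod (\<psi> x t))\<^sup>2) \<partial>torus) \<partial>circle)"
    using torus_circle.integral_snd[OF int'] by (simp add: c_def mult.assoc del: of_real_power)
  have meas: "(\<lambda>t. cis (- (of_int s * t)) * (\<integral>x. c x * of_real ((cmod (S m t x))\<^sup>2) \<partial>torus)) \<in> borel_measurable circle" for m
  proof -
    have "continuous_on UNIV (\<lambda>t. if P then f t else (0::complex))"
      if "continuous_on UNIV f" for P and f :: "real \<Rightarrow> complex"
      using that by (cases P) auto
    note [continuous_intros] = this
    show ?thesis
      unfolding S_def c_def trig_poly_density_coeff evolved_def
      by (intro measurable_circle borel_measurable_continuous_onI continuous_intros)
  qed
  have lim_t: "(\<lambda>m. cis (- (of_int s * t)) * (\<integral>x. c x * of_real ((cmod (S m t x))\<^sup>2) \<partial>torus))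
      \<longlonglongrightarrow> cis (- (of_int s * t)) * (\<integral>x. c x * of_real ((cmod (\<psi> x t))\<^sup>2) \<partial>torus)"
    if "t \<in> space circle" for t
    using that c1 by (intro tendsto_intros lim) auto
  have "(\<lambda>m. \<integral>t. cis (- (of_int s * t)) * (\<integral>x. c x * of_real ((cmod (S m t x))\<^sup>2) \<partial>torus) \<partial>circle)
      \<longlonglongrightarrow> (\<integral>t. cis (- (of_int s * t)) * (\<integral>x. c x * of_real ((cmod (\<psi> x t))\<^sup>2) \<partial>torus) \<partial>circle)"
  proof (rule integral_dominated_convergence[where w = "\<lambda>_. B"])
    show "(\<lambda>t. cis (- (of_int s * t)) * (\<integral>x. c x * of_real ((cmod (\<psi> x t))\<^sup>2) \<partial>torus)) \<in> borel_measurable circle"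
      by (rule borel_measurable_LIMSEQ_metric[OF meas lim_t])
    show "AE t in circle. norm (cis (- (of_int s * t)) * (\<integral>x. c x * of_real ((cmod (S m t x))\<^sup>2) \<partial>torus)) \<le> B" for m
    proof (rule AE_I2)
      fix t
      have "cmod (\<integral>x. c x * of_real ((cmod (S m t x))\<^sup>2) \<partial>torus) \<le> (\<integral>x. cmod (c x * of_real ((cmod (S m t x))\<^sup>2)) \<partial>torus)"
        by (rule Bochner_Integration.integral_norm_bound)
      also have "\<dots> = (\<integral>x. (cmod (S m t x))\<^sup>2 \<partial>torus)"
        by (simp add: norm_mult c_def del: of_real_power)
      finally show "norm (cis (- (of_int s * t)) * (\<integral>x. c x * of_real ((cmod (S m t x))\<^sup>2) \<partial>torus)) \<le> B"
        using SB[of m t] by (simp add: norm_mult del: of_real_power)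
    qed
  qed (use meas lim_t in auto)
  then show ?thesis
    unfolding eq S_def c_def integral_trig_poly_density e_def .
qed

section \<open>Coefficients of the accumulation point and their uniform bounds\<close>

lemma integrable_Linf_L1:
  fixes \<nu> :: "real ^ 'd \<Rightarrow> real \<Rightarrow> real"
  assumes "\<nu> \<in> Linf_L1"
  shows "integrable (torus \<Otimes>\<^sub>M circle) (\<lambda>(x, t). \<nu> x t)"
proof (rule integrableI_bounded)
  show [measurable]: "(\<lambda>(x, t). \<nu> x t) \<in> borel_measurable (torus \<Otimes>\<^sub>M circle)"
    using assms by (simp add: Linf_L1_def)
  obtain C where C: "AE t in circle. integrable torus (\<lambda>x. \<nu> x t) \<and> (\<integral>x. \<bar>\<nu> x t\<bar> \<partial>torus) \<le> C"
    using assms by (auto simp: Linf_L1_def)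
  have "(\<integral>\<^sup>+p. ennreal (norm (case p of (x, t) \<Rightarrow> \<nu> x t)) \<partial>(torus \<Otimes>\<^sub>M circle))
      = (\<integral>\<^sup>+t. \<integral>\<^sup>+x. ennreal \<bar>\<nu> x t\<bar> \<partial>torus \<partial>circle)"
    by (subst torus_circle.nn_integral_snd[symmetric]) (auto simp: split_beta')
  also have "\<dots> \<le> (\<integral>\<^sup>+t. ennreal C \<partial>circle)"
    by (rule nn_integral_mono_AE, use C in eventually_elim)
       (auto simp: nn_integral_eq_integral intro!: ennreal_leI)
  also have "\<dots> < \<infinity>"
    using circle.emeasure_finite[of "space circle"] by (simp add: ennreal_mult_eq_top_iff less_top[symmetric])
  finally show "(\<integral>\<^sup>+p. ennreal (norm (case p of (x, t) \<Rightarrow> \<nu> x t)) \<partial>(torus \<Otimes>\<^sub>M circle)) < \<infinity>" .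
qed

lemma continuous_torus_character:
  fixes l :: "int ^ 'd"
  shows "continuous_torus (\<lambda>x. cis (- (int_vec l \<bullet> x)))"
  unfolding continuous_torus_def
proof (intro conjI allI)
  show "continuous_on UNIV (\<lambda>x. cis (- (int_vec l \<bullet> x)))"
    by (intro continuous_intros)
next
  fix x :: "real ^ 'd" and k :: "int ^ 'd"
  define n where "n = (\<Sum>i\<in>UNIV. l $ i * k $ i)"
  have "int_vec l \<bullet> int_vec k = of_int n"
    by (simp add: n_def int_vec_def inner_vec_def)
  then have "- (int_vec l \<bullet> (x + (2 * pi) *\<^sub>R int_vec k)) = - (int_vec l \<bullet> x) + 2 * pi * of_int (- n)"
    by (simp add: inner_add_right)
  moreover have "cis (2 * pi * of_int (- n)) = 1" by (rule cis_multiple_2pi) simp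
  ultimately show "cis (- (int_vec l \<bullet> (x + (2 * pi) *\<^sub>R int_vec k))) = cis (- (int_vec l \<bullet> x))"
    by (simp only: cis_mult[symmetric])  simp
qed

text \<open>
  The left-hand side is the limit that weak-\<open>*\<close> convergence provides for a character as test function.
\<close>

lemma density_family_coeff:
  fixes \<nu> :: "real ^ 'd \<Rightarrow> real \<Rightarrow> real"
  assumes \<nu>: "\<nu> \<in> Linf_L1" and nonneg: "AE t in circle. AE x in torus. 0 \<le> \<nu> x t"
    and "density_family \<nu> \<in> Linf_measures"
  shows "(\<integral>t. cis (- (of_int s * t)) * (\<integral>x. cis (- (int_vec l \<bullet> x)) \<partial>density_family \<nu> t) \<partial>circle)
     = (2 * pi) ^ (CARD('d) + 1) * spacetime_fourier_coeff \<nu> (l, s)"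
proof -
  define c where "c x = cis (- (int_vec l \<bullet> x))" for x :: "real ^ 'd"
  have [measurable]: "(\<lambda>(x, t). \<nu> x t) \<in> borel_measurable (torus \<Otimes>\<^sub>M circle)"
    using \<nu> by (simp add: Linf_L1_def)
  have [measurable]: "c \<in> borel_measurable torus"
    unfolding c_def by (intro measurable_torus borel_measurable_continuous_onI continuous_intros)
  have [measurable]: "(\<lambda>t. cis (- (of_int s * t))) \<in> borel_measurable circle"
    using measurable_character_circle[of "- of_int s"] by simp
  have [measurable]: "(\<lambda>t. \<integral>x. c x \<partial>density_family \<nu> t) \<in> borel_measurable circle"
    using assms(3) continuous_torus_character[of l] by (simp add: Linf_measures_def c_def)
  have int: "integrable (torus \<Otimes>\<^sub>M circle) (\<lambda>(x, t). cis (- (of_int s * t)) * (\<nu> x t *\<^sub>R c x))"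
  proof (rule Bochner_Integration.integrable_bound[OF integrable_Linf_L1[OF \<nu>]])
    show "(\<lambda>(x, t). cis (- (of_int s * t)) * (\<nu> x t *\<^sub>R c x)) \<in> borel_measurable (torus \<Otimes>\<^sub>M circle)"
      by measurable
  qed (auto simp: norm_mult c_def)
  have "(\<integral>t. cis (- (of_int s * t)) * (\<integral>x. c x \<partial>density_family \<nu> t) \<partial>circle)
      = (\<integral>t. (\<integral>x. cis (- (of_int s * t)) * (\<nu> x t *\<^sub>R c x) \<partial>torus) \<partial>circle)"
  proof (rule integral_cong_AE)
    have "(\<lambda>(t, x). cis (- (of_int s * t)) * (\<nu> x t *\<^sub>R c x)) \<in> borel_measurable (circle \<Otimes>\<^sub>M torus)"
      using measurable_pair_swap[OF borel_measurable_integrable[OF int]] by (simp add: split_beta')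
    then show "(\<lambda>t. \<integral>x. cis (- (of_int s * t)) * (\<nu> x t *\<^sub>R c x) \<partial>torus) \<in> borel_measurable circle"
      by (rule torus.borel_measurable_lebesgue_integral)
    show "AE t in circle. cis (- (of_int s * t)) * (\<integral>x. c x \<partial>density_family \<nu> t) =
        (\<integral>x. cis (- (of_int s * t)) * (\<nu> x t *\<^sub>R c x) \<partial>torus)"
      using nonneg AE_space
    proof eventually_elim
      fix t assume pos: "AE x in torus. 0 \<le> \<nu> x t" and t: "t \<in> space circle"
      have "(\<lambda>x. \<nu> x t) \<in> borel_measurable torus" using t by measurable
      then show "cis (- (of_int s * t)) * (\<integral>x. c x \<partial>density_family \<nu> t) =
          (\<integral>x. cis (- (of_int s * t)) * (\<nu> x t *\<^sub>R c x) \<partial>torus)"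
        unfolding density_family_def using pos by (simp add: integral_density del: mult_scaleR_right)
    qed
  qed measurable
  also have "\<dots> = (\<integral>(x, t). cis (- (of_int s * t)) * (\<nu> x t *\<^sub>R c x) \<partial>(torus \<Otimes>\<^sub>M circle))"
    by (rule torus_circle.integral_snd[OF int])
  also have "\<dots> = (\<integral>(x, t). of_real (\<nu> x t) * cis (- (int_vec l \<bullet> x + of_int s * t)) \<partial>(torus \<Otimes>\<^sub>M circle))"
  proof (rule Bochner_Integration.integral_cong[OF refl])
    have "cis (- (of_int s * t)) * (\<nu> x t *\<^sub>R c x) = of_real (\<nu> x t) * cis (- (int_vec l \<bullet> x + of_int s * t))" for x t
    proof -
      have "cis (- (int_vec l \<bullet> x + of_int s * t)) = cis (- (of_int s * t)) * c x"
        by (simp add: c_def cis_mult algebra_simps)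
      then show ?thesis by (simp add: scaleR_conv_of_real)
    qed
    then show "(case p of (x, t) \<Rightarrow> cis (- (of_int s * t)) * (\<nu> x t *\<^sub>R c x)) =
        (case p of (x, t) \<Rightarrow> of_real (\<nu> x t) * cis (- (int_vec l \<bullet> x + of_int s * t)))" for p
      by (cases p) simp
  qed
  finally show ?thesis by (simp add: spacetime_fourier_coeff_def c_def)
qed

lemma inj_int_vec: "inj int_vec"
  by (rule injI) (simp add: int_vec_def vec_eq_iff)

lemma norm_density_coeff_le_chord_sum:
  fixes K :: "(int ^ 'd) set"
  assumes "finite K"
  shows "cmod (density_coeff e K l s)
     \<le> chord_sum (\<lambda>y. cmod (e (inv int_vec y))) (int_vec ` K) (int_vec l, of_int s)"
proof -
  let ?P = "\<lambda>k. k - l \<in> K \<and> (norm (int_vec (k - l)))\<^sup>2 - (norm (int_vec k))\<^sup>2 = real_of_int s"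
  let ?w = "\<lambda>y. cmod (e (inv int_vec y))"
  have w: "?w (int_vec k) = cmod (e k)" for k :: "int ^ 'd" by (simp add: inj_int_vec)
  have "cmod (density_coeff e K l s)
      \<le> (\<Sum>k\<in>K. cmod (\<Sum>k'\<in>K. if k - k' = l \<and> (norm (int_vec k'))\<^sup>2 - (norm (int_vec k))\<^sup>2 = real_of_int s
           then e k * cnj (e k') else 0))"
    unfolding density_coeff_def by (rule norm_sum)
  also have "\<dots> = (\<Sum>k\<in>K. if ?P k then cmod (e k) * cmod (e (k - l)) else 0)"
  proof (intro sum.cong refl)
    fix k assume "k \<in> K"
    have "(\<Sum>k'\<in>K. if k - k' = l \<and> (norm (int_vec k'))\<^sup>2 - (norm (int_vec k))\<^sup>2 = real_of_int s
           then e k * cnj (e k') else 0) =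
        (\<Sum>k'\<in>K. if k' = k - l then (if ?P k then e k * cnj (e (k - l)) else 0) else 0)"
      by (intro sum.cong refl) auto
    also have "\<dots> = (if ?P k then e k * cnj (e (k - l)) else 0)"
      using assms by (simp add: sum.delta)
    finally show "cmod (\<Sum>k'\<in>K. if k - k' = l \<and> (norm (int_vec k'))\<^sup>2 - (norm (int_vec k))\<^sup>2 = real_of_int s
           then e k * cnj (e k') else 0) = (if ?P k then cmod (e k) * cmod (e (k - l)) else 0)"
      by (simp add: norm_mult)
  qed
  also have "\<dots> = (\<Sum>k\<in>{k\<in>K. ?P k}. cmod (e k) * cmod (e (k - l)))"
    using assms by (simp add: sum.inter_filter)
  also have "\<dots> = (\<Sum>y\<in>int_vec ` {k\<in>K. ?P k}. ?w y * ?w (y - int_vec l))"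
    by (subst sum.reindex) (auto intro: inj_on_subset[OF inj_int_vec] simp: w int_vec_diff[symmetric])
  also have "int_vec ` {k\<in>K. ?P k} = chords (int_vec ` K) (int_vec l, of_int s)"
    by (auto simp: chords_def int_vec_diff[symmetric] dest!: injD[OF inj_int_vec])
  finally show ?thesis by (simp add: chord_sum_def)
qed

text \<open>
  The bound for finitely supported initial data that survives both limits: it holds uniformly in the
  cut-off \<open>K\<close>, and the radius \<open>R\<close> depends on \<open>F\<close> only. Truncating at \<open>0\<close> after subtracting
  the contribution of the frequencies of norm at most \<open>R\<close> leaves the far chords.
\<close>

lemma density_coeff_bound:
  fixes F :: "((int ^ 'd) \<times> int) set"
  assumes "finite F" and nz: "\<And>\<tau>. \<tau> \<in> F \<Longrightarrow> fst \<tau> \<noteq> 0"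
  shows "\<exists>R. \<forall>e K \<epsilon> (B :: real). finite K \<longrightarrow>
      (\<Sum>k\<in>{k\<in>K. norm (int_vec k) \<le> R}. (cmod (e k))\<^sup>2) \<le> \<epsilon> \<longrightarrow> (\<Sum>k\<in>K. (cmod (e k))\<^sup>2) \<le> B \<longrightarrow>
      (\<Sum>(l, s)\<in>F. (max 0 (cmod (density_coeff e K l s) - 2 * (sqrt \<epsilon> * sqrt B))) ^ CARD('d))
        \<le> CARD('d) * B ^ CARD('d)"
proof -
  define j where "j = (\<lambda>(l, s). (int_vec l, real_of_int s) :: (real ^ 'd) \<times> real)"
  have "inj j" using injD[OF inj_int_vec] by (auto simp: inj_def j_def)
  have "finite (j ` F)" using assms(1) by simp
  moreover have "fst \<tau> \<noteq> 0" if "\<tau> \<in> j ` F" for \<tau>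
    using that nz by (force simp: j_def int_vec_def vec_eq_iff)
  ultimately obtain R where R: "\<And>K (w :: real ^ 'd \<Rightarrow> real). finite K \<Longrightarrow> (\<forall>k\<in>K. norm k > R) \<Longrightarrow> (\<forall>k. 0 \<le> w k) \<Longrightarrow>
      (\<Sum>\<tau>\<in>j ` F. chord_sum w K \<tau> ^ CARD('d)) \<le> CARD('d) * (\<Sum>k\<in>K. (w k)\<^sup>2) ^ CARD('d)"
    using far_chord_bound[of "j ` F"] by metis
  show ?thesis
  proof (rule exI[of _ R], intro allI impI)
    fix e :: "int ^ 'd \<Rightarrow> complex" and K \<epsilon> B
    assume K: "finite K" and near: "(\<Sum>k\<in>{k\<in>K. norm (int_vec k) \<le> R}. (cmod (e k))\<^sup>2) \<le> \<epsilon>"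
      and mass: "(\<Sum>k\<in>K. (cmod (e k))\<^sup>2) \<le> B"
    define w where "w y = cmod (e (inv int_vec y))" for y :: "real ^ 'd"
    let ?K = "int_vec ` K" and ?far = "{y\<in>int_vec ` K. R < norm y}"
    have w: "w (int_vec k) = cmod (e k)" for k by (simp add: w_def inj_int_vec)
    have transfer: "(\<Sum>y\<in>int_vec ` A. (w y)\<^sup>2) = (\<Sum>k\<in>A. (cmod (e k))\<^sup>2)" for A
      by (subst sum.reindex) (auto intro: inj_on_subset[OF inj_int_vec] simp: w)
    have "{y\<in>?K. norm y \<le> R} = int_vec ` {k\<in>K. norm (int_vec k) \<le> R}" by auto
    then have near': "(\<Sum>y\<in>{y\<in>?K. norm y \<le> R}. (w y)\<^sup>2) \<le> \<epsilon>" using near by (simp only: transfer)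
    have mass': "(\<Sum>y\<in>?K. (w y)\<^sup>2) \<le> B" using mass by (simp only: transfer)
    have "(\<Sum>(l, s)\<in>F. (max 0 (cmod (density_coeff e K l s) - 2 * (sqrt \<epsilon> * sqrt B))) ^ CARD('d))
        \<le> (\<Sum>\<tau>\<in>F. chord_sum w ?far (j \<tau>) ^ CARD('d))"
    proof (rule sum_mono)
      fix \<tau> assume "\<tau> \<in> F"
      obtain l s where \<tau>: "\<tau> = (l, s)" by force
      have "cmod (density_coeff e K l s) \<le> chord_sum w ?K (j \<tau>)"
        using norm_density_coeff_le_chord_sum[OF K, of e l s] by (simp add: w_def[abs_def] j_def \<tau>)
      also have "\<dots> \<le> chord_sum w ?far (j \<tau>) + 2 * (sqrt \<epsilon> * sqrt B)"
        using K near' mass' by (intro chord_sum_le_far_plus_near) (auto simp: w_def)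
      finally have "max 0 (cmod (density_coeff e K l s) - 2 * (sqrt \<epsilon> * sqrt B)) \<le> chord_sum w ?far (j \<tau>)"
        using chord_sum_nonneg[of ?far w "j \<tau>"] by (simp add: w_def)
      then show "(case \<tau> of (l, s) \<Rightarrow> (max 0 (cmod (density_coeff e K l s) - 2 * (sqrt \<epsilon> * sqrt B))) ^ CARD('d))
          \<le> chord_sum w ?far (j \<tau>) ^ CARD('d)"
        unfolding \<tau> prod.case by (intro power_mono) auto
    qed
    also have "\<dots> = (\<Sum>\<tau>\<in>j ` F. chord_sum w ?far \<tau> ^ CARD('d))"
      by (subst sum.reindex) (auto intro: inj_on_subset[OF \<open>inj j\<close>])
    also have "\<dots> \<le> CARD('d) * (\<Sum>y\<in>?far. (w y)\<^sup>2) ^ CARD('d)"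
      using K by (intro R) (auto simp: w_def)
    also have "\<dots> \<le> CARD('d) * B ^ CARD('d)"
    proof -
      have "(\<Sum>y\<in>?far. (w y)\<^sup>2) \<le> (\<Sum>y\<in>?K. (w y)\<^sup>2)" using K by (intro sum_mono2) auto
      then show ?thesis using mass' by (intro mult_left_mono power_mono sum_nonneg) auto
    qed
    finally show "(\<Sum>(l, s)\<in>F. (max 0 (cmod (density_coeff e K l s) - 2 * (sqrt \<epsilon> * sqrt B))) ^ CARD('d))
        \<le> CARD('d) * B ^ CARD('d)" .
  qed
qed

text \<open>
  For every \<open>\<delta> > 0\<close> the ball of radius \<open>R\<close> lies below \<open>\<delta> / h n\<close> once \<open>n\<close> is large.
\<close>

lemma low_frequency_mass_vanishes:
  fixes c :: "nat \<Rightarrow> int ^ 'd \<Rightarrow> complex"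
  assumes h: "\<And>n. h n > 0" "h \<longlonglongrightarrow> 0"
    and low: "((\<lambda>\<delta>. limsup (\<lambda>n. \<Sum>\<^sub>\<infinity>l\<in>{l. norm (int_vec l) < \<delta> / h n}.
            ennreal ((cmod (c n l))\<^sup>2))) \<longlongrightarrow> 0) (at_right 0)"
    and "\<epsilon> > 0"
  shows "\<forall>\<^sub>F n in sequentially. \<forall>K. finite K \<longrightarrow>
           (\<Sum>k\<in>{k\<in>K. norm (int_vec k) \<le> R}. (cmod (c n k))\<^sup>2) \<le> \<epsilon>"
proof -
  have "\<forall>\<^sub>F \<delta> in at_right 0. limsup (\<lambda>n. \<Sum>\<^sub>\<infinity>l\<in>{l. norm (int_vec l) < \<delta> / h n}. ennreal ((cmod (c n l))\<^sup>2)) < ennreal \<epsilon>"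
    using low \<open>\<epsilon> > 0\<close> by (intro order_tendstoD) auto
  then have "\<forall>\<^sub>F \<delta> in at_right 0. (0::real) < \<delta> \<and>
      limsup (\<lambda>n. \<Sum>\<^sub>\<infinity>l\<in>{l. norm (int_vec l) < \<delta> / h n}. ennreal ((cmod (c n l))\<^sup>2)) < ennreal \<epsilon>"
    using eventually_at_right_less[of "0::real"] by eventually_elim simp
  then obtain \<delta> where "\<delta> > 0" and
    \<delta>: "limsup (\<lambda>n. \<Sum>\<^sub>\<infinity>l\<in>{l. norm (int_vec l) < \<delta> / h n}. ennreal ((cmod (c n l))\<^sup>2)) < ennreal \<epsilon>"
    using eventually_happens'[OF trivial_limit_at_right_real] by blast
  have "\<forall>\<^sub>F n in sequentially. h n < \<delta> / (\<bar>R\<bar> + 1)"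
    using h(2) \<open>\<delta> > 0\<close> by (intro order_tendstoD) auto
  with Limsup_lessD[OF \<delta>] show ?thesis
  proof eventually_elim
    case (elim n)
    have "(\<bar>R\<bar> + 1) * h n < \<delta>" using elim(2) by (simp add: field_simps)
    then have "\<bar>R\<bar> + 1 < \<delta> / h n" using h(1)[of n] by (simp add: field_simps)
    then have sub: "norm (int_vec k) < \<delta> / h n" if "norm (int_vec k) \<le> R" for k :: "int ^ 'd"
      using that by linarith
    show ?case
    proof (intro allI impI)
      fix K :: "(int ^ 'd) set" assume "finite K"
      have "ennreal (\<Sum>k\<in>{k\<in>K. norm (int_vec k) \<le> R}. (cmod (c n k))\<^sup>2)
          = (\<Sum>k\<in>{k\<in>K. norm (int_vec k) \<le> R}. ennreal ((cmod (c n k))\<^sup>2))"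
        by (rule sum_ennreal[symmetric]) simp
      also have "\<dots> \<le> (\<Sum>\<^sub>\<infinity>l\<in>{l. norm (int_vec l) < \<delta> / h n}. ennreal ((cmod (c n l))\<^sup>2))"
        using \<open>finite K\<close> sub by (subst nonneg_infsum_complete) (auto intro!: SUP_upper)
      also have "\<dots> \<le> ennreal \<epsilon>" using elim(1) by simp
      finally show "(\<Sum>k\<in>{k\<in>K. norm (int_vec k) \<le> R}. (cmod (c n k))\<^sup>2) \<le> \<epsilon>"
        using \<open>\<epsilon> > 0\<close> by (simp add: ennreal_le_iff)
    qed
  qed
qed

section \<open>Summability of the coefficients\<close>

theorem theorem1p2:
  fixes u :: "nat \<Rightarrow> real ^ 'd \<Rightarrow> complex"
    and \<psi> :: "nat \<Rightarrow> real ^ 'd \<Rightarrow> real \<Rightarrow> complex"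
    and h :: "nat \<Rightarrow> real"
    and \<nu> :: "real ^ 'd \<Rightarrow> real \<Rightarrow> real"
  assumes "\<And>n. u n \<in> L2_torus"
    and "\<exists>C. \<forall>n. L2_norm_torus (u n) \<le> C"
    and "\<And>n. h n > 0" and "h \<longlonglongrightarrow> 0"
    and "((\<lambda>\<delta>. limsup (\<lambda>n. \<Sum>\<^sub>\<infinity>l\<in>{l. norm (int_vec l) < \<delta> / h n}.
            ennreal ((cmod (fourier_coeff (u n) l))\<^sup>2))) \<longlongrightarrow> 0) (at_right 0)"
    and "((\<lambda>R. limsup (\<lambda>n. \<Sum>\<^sub>\<infinity>l\<in>{l. norm (int_vec l) > R / h n}.
            ennreal ((cmod (fourier_coeff (u n) l))\<^sup>2))) \<longlongrightarrow> 0) at_top"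
    and "\<And>n. schroedinger_evolution (u n) (\<psi> n)"
    and "\<nu> \<in> Linf_L1"
    and "AE t in circle. AE x in torus. 0 \<le> \<nu> x t"
    and "weak_star_accumulation_point (\<lambda>n x t. (cmod (\<psi> n x t))\<^sup>2) (density_family \<nu>)"
  shows "lp_norm (real CARD('d)) (spacetime_fourier_coeff \<nu>) < \<infinity>"
proof -
  let ?d = "CARD('d)"
  let ?c = "spacetime_fourier_coeff \<nu>"
  obtain C where C: "\<And>n. L2_norm_torus (u n) \<le> C" using assms(2) by blast
  \<comment> \<open>The bound that Bessel's inequality gives for the squared coefficients; the Fourier coefficients are
      normalised by the volume of the torus.\<close>
  define B where "B = C\<^sup>2 / (2 * pi) ^ ?d"
  define e where "e n = fourier_coeff (u n)" for n
  define I where "I n l s = (\<integral>(x, t). cis (- (of_int s * t)) * cis (- (int_vec l \<bullet> x)) * of_real ((cmod (\<psi> n x t))\<^sup>2)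
            \<partial>(torus \<Otimes>\<^sub>M circle)) / (2 * pi) ^ (?d + 1)" for n l s
  have mass: "(\<Sum>k\<in>K. (cmod (e n k))\<^sup>2) \<le> B" if "finite K" for K n
  proof -
    have "(L2_norm_torus (u n))\<^sup>2 \<le> C\<^sup>2"
      using C[of n] by (intro power_mono) (auto simp: L2_norm_torus_def)
    then show ?thesis
      using bessel_torus[OF assms(1) that, of n] by (simp add: B_def e_def pos_le_divide_eq mult.commute)
  qed
  have lim_m: "(\<lambda>m. density_coeff (e n) (exhaustion m) l s) \<longlonglongrightarrow> I n l s" for n l s
  proof -
    have "(\<lambda>m. (2 * pi) ^ (?d + 1) * density_coeff (e n) (exhaustion m) l s / (2 * pi) ^ (?d + 1)) \<longlonglongrightarrow> I n l s"
      unfolding I_def e_def using evolution_density[OF assms(1,7)] by (intro tendsto_divide) auto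
    then show ?thesis by simp
  qed
  obtain r where "strict_mono r" and weak: "\<And>(\<phi> :: real \<Rightarrow> complex) a. integrable circle \<phi> \<Longrightarrow> continuous_torus a \<Longrightarrow>
         (\<lambda>n. \<integral>(x, t). \<phi> t * a x * of_real ((cmod (\<psi> (r n) x t))\<^sup>2) \<partial>(torus \<Otimes>\<^sub>M circle))
           \<longlonglongrightarrow> (\<integral>t. \<phi> t * (\<integral>x. a x \<partial>density_family \<nu> t) \<partial>circle)"
    using assms(10) by (auto simp: weak_star_accumulation_point_def)
  have lim_n: "(\<lambda>n. I (r n) l s) \<longlonglongrightarrow> ?c (l, s)" for l s
  proof -
    have "density_family \<nu> \<in> Linf_measures"
      using assms(10) by (simp add: weak_star_accumulation_point_def)
    then have "(\<lambda>n. \<integral>(x, t). cis (- (of_int s * t)) * cis (- (int_vec l \<bullet> x)) * of_real ((cmod (\<psi> (r n) x t))\<^sup>2)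
        \<partial>(torus \<Otimes>\<^sub>M circle)) \<longlonglongrightarrow> (2 * pi) ^ (?d + 1) * ?c (l, s)"
      using weak[OF _ continuous_torus_character[of l], of "\<lambda>t. cis (- (of_int s * t))"]
        integrable_cis_circle[of "- of_int s"] density_family_coeff[OF assms(8,9), of s l] by simp
    then have "(\<lambda>n. I (r n) l s) \<longlonglongrightarrow> (2 * pi) ^ (?d + 1) * ?c (l, s) / (2 * pi) ^ (?d + 1)"
      unfolding I_def by (intro tendsto_divide) auto
    then show ?thesis by simp
  qed
  have zero: "?c (0, s) = 0" if "s \<noteq> 0" for s
  proof -
    \<comment> \<open>For \<open>l = 0\<close> both ends of a chord coincide, which forces \<open>s = 0\<close>.\<close>
    have "density_coeff (e n) K 0 s = 0" for n K
      unfolding density_coeff_def using that by (intro sum.neutral ballI) auto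
    then have "I n 0 s = 0" for n
      using lim_m[of n 0 s] by (simp add: LIMSEQ_const_iff)
    then show ?thesis using lim_n[of 0 s] by (simp add: LIMSEQ_const_iff)
  qed
  have bound: "(\<Sum>\<tau>\<in>F. cmod (?c \<tau>) ^ ?d) \<le> ?d * B ^ ?d"
    if F: "finite F" "\<And>\<tau>. \<tau> \<in> F \<Longrightarrow> fst \<tau> \<noteq> 0" for F
  proof -
    obtain R where R: "\<forall>e K \<epsilon> (B :: real). finite K \<longrightarrow>
        (\<Sum>k\<in>{k\<in>K. norm (int_vec k) \<le> R}. (cmod (e k))\<^sup>2) \<le> \<epsilon> \<longrightarrow> (\<Sum>k\<in>K. (cmod (e k))\<^sup>2) \<le> B \<longrightarrow>
        (\<Sum>(l, s)\<in>F. (max 0 (cmod (density_coeff e K l s) - 2 * (sqrt \<epsilon> * sqrt B))) ^ ?d) \<le> ?d * B ^ ?d"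
      using density_coeff_bound[OF F] ..
    have limit: "(\<Sum>(l, s)\<in>F. (max 0 (cmod (?c (l, s)) - 2 * (sqrt \<epsilon> * sqrt B))) ^ ?d) \<le> ?d * B ^ ?d"
      if "\<epsilon> > 0" for \<epsilon>
    proof -
      have near: "\<forall>\<^sub>F n in sequentially. \<forall>K. finite K \<longrightarrow>
           (\<Sum>k\<in>{k\<in>K. norm (int_vec k) \<le> R}. (cmod (e (r n) k))\<^sup>2) \<le> \<epsilon>"
        using low_frequency_mass_vanishes[OF assms(3-5) that, of R] \<open>strict_mono r\<close>
        unfolding e_def by (rule eventually_subseq[rotated])
      have "(\<lambda>n. \<Sum>(l, s)\<in>F. (max 0 (cmod (I (r n) l s) - 2 * (sqrt \<epsilon> * sqrt B))) ^ ?d)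
          \<longlonglongrightarrow> (\<Sum>(l, s)\<in>F. (max 0 (cmod (?c (l, s)) - 2 * (sqrt \<epsilon> * sqrt B))) ^ ?d)"
        unfolding split_beta by (intro tendsto_intros lim_n[unfolded split_beta])
      moreover have "\<forall>\<^sub>F n in sequentially.
          (\<Sum>(l, s)\<in>F. (max 0 (cmod (I (r n) l s) - 2 * (sqrt \<epsilon> * sqrt B))) ^ ?d) \<le> ?d * B ^ ?d"
        using near
      proof eventually_elim
        case (elim n)
        have "(\<lambda>m. \<Sum>(l, s)\<in>F. (max 0 (cmod (density_coeff (e (r n)) (exhaustion m) l s) - 2 * (sqrt \<epsilon> * sqrt B))) ^ ?d)
            \<longlonglongrightarrow> (\<Sum>(l, s)\<in>F. (max 0 (cmod (I (r n) l s) - 2 * (sqrt \<epsilon> * sqrt B))) ^ ?d)"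
          unfolding split_beta by (intro tendsto_intros lim_m)
        moreover have "(\<Sum>(l, s)\<in>F. (max 0 (cmod (density_coeff (e (r n)) (exhaustion m) l s)
            - 2 * (sqrt \<epsilon> * sqrt B))) ^ ?d) \<le> ?d * B ^ ?d" for m
          using elim mass finite_exhaustion by (intro R[rule_format]) auto
        ultimately show ?case by (intro LIMSEQ_le_const2) auto
      qed
      ultimately show ?thesis
        using tendsto_upperbound[OF _ _ sequentially_bot] by blast
    qed
    \<comment> \<open>Let the mass \<open>\<epsilon>\<close> of the near frequencies tend to \<open>0\<close>.\<close>
    have "((\<lambda>\<epsilon>. \<Sum>(l, s)\<in>F. (max 0 (cmod (?c (l, s)) - 2 * (sqrt \<epsilon> * sqrt B))) ^ ?d)
        \<longlongrightarrow> (\<Sum>(l, s)\<in>F. (max 0 (cmod (?c (l, s)) - 2 * (sqrt 0 * sqrt B))) ^ ?d)) (at_right 0)"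
      unfolding split_beta by (intro tendsto_intros)
    then have "(\<Sum>(l, s)\<in>F. (max 0 (cmod (?c (l, s)) - 2 * (sqrt 0 * sqrt B))) ^ ?d) \<le> ?d * B ^ ?d"
      by (rule tendsto_upperbound)
         (use limit eventually_at_right_less[of "0::real"] in \<open>auto elim: eventually_mono\<close>)
    then show ?thesis by (simp add: split_beta)
  qed
  have "(\<lambda>\<tau>. cmod (?c \<tau>) ^ ?d) summable_on UNIV"
  proof (rule nonneg_bounded_partial_sums_imp_summable_on)
    have "(\<Sum>\<tau>\<in>X. cmod (?c \<tau>) ^ ?d) \<le> ?d * B ^ ?d + cmod (?c (0, 0)) ^ ?d" if "finite X" for X
    proof -
      have "(\<Sum>\<tau>\<in>X. cmod (?c \<tau>) ^ ?d) \<le>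
          (\<Sum>\<tau>\<in>X. (if fst \<tau> \<noteq> 0 then cmod (?c \<tau>) ^ ?d else 0) + (if \<tau> = (0, 0) then cmod (?c (0, 0)) ^ ?d else 0))"
      proof (rule sum_mono)
        fix \<tau> :: "(int ^ 'd) \<times> int"
        have "?c \<tau> = 0" if "fst \<tau> = 0" "\<tau> \<noteq> (0, 0)"
          using zero[of "snd \<tau>"] that by (cases \<tau>) auto
        then show "cmod (?c \<tau>) ^ ?d \<le>
            (if fst \<tau> \<noteq> 0 then cmod (?c \<tau>) ^ ?d else 0) + (if \<tau> = (0, 0) then cmod (?c (0, 0)) ^ ?d else 0)"
          by (auto simp: zero_power)
      qed
      also have "\<dots> = (\<Sum>\<tau>\<in>{\<tau>\<in>X. fst \<tau> \<noteq> 0}. cmod (?c \<tau>) ^ ?d) + (if (0, 0) \<in> X then cmod (?c (0, 0)) ^ ?d else 0)"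
        using that by (simp add: sum.distrib sum.inter_filter sum.delta)
      also have "\<dots> \<le> ?d * B ^ ?d + cmod (?c (0, 0)) ^ ?d"
        using that by (intro add_mono bound) auto
      finally show ?thesis .
    qed
    then show "\<forall>\<^sub>F X in finite_subsets_at_top UNIV. (\<Sum>\<tau>\<in>X. cmod (?c \<tau>) ^ ?d) \<le> ?d * B ^ ?d + cmod (?c (0, 0)) ^ ?d"
      by (auto intro: eventually_finite_subsets_at_top_weakI)
  qed simp
  then show ?thesis
    by (simp add: lp_norm_def powr_realpow')
qed

end
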